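(* Let $K$ be a number field and let $D\subset\mathbb{P}^3_K$ be the closed subvariety \[ D = H_1\cup H_2\cup H_3\cup H_4\cup L_1\cup\dots\cup L_r, \] where $H_1,\dots,H_4$ are planes defined over $K$ in general position and $L_1,\dots,L_r$ are lines defined over $K$ all passing through a common $K$-rational point $p$. Suppose that none of $L_1,\dots,L_r$ intersects any of the six lines $H_i\cap H_j$, $1\le i<j\le 4$. Then the integral points on $\mathbb{P}^3_K\setminus D$ are potentially dense.
   Context: Let $K$ be a number field and $S$ a finite set of places of $K$ containing all archimedean places; $\mathcal{O}_S=\{x\in K: v(x)\ge 0 \text{ for all finite } v\notin S\}$. For a finite place $v$, $\mathcal{O}_v$ is the valuation ring, $\mathfrak{m}_v$ its maximal ideal and $k_v$ its residue field. Reduction: for a closed subvariety $Z\subset\mathbb{P}^n_K$ with radical homogeneous ideal $I\subset K[X_0,\dots,X_n]$, $Z_v\subset\mathbb{P}^n_{k_v}$ is the zero set of the image of $I\cap\mathcal{O}_v[X_0,\dots,X_n]$ in $k_v[X_0,\dots,X_n]$. For $x\in\mathbb{P}^n(K)$, $x_v\in\mathbb{P}^n(k_v)$ is its reduction; $x$ reduces to $Z$ at $v$ if $x_v\in Z_v$. For a projective $X\subset\mathbb{P}^n_K$ and a proper closed subvariety $D\subset X$, $x\in X(K)$ is an $S$-integral point of $X\setminus D$ if for every finite place $v\notin S$, $x$ does not reduce to $D$ at $v$; the set of these is $(X\setminus D)(\mathcal{O}_S)$. The integral points on $X\setminus D$ are potentially dense if there exist a finite extension $K'/K$ and a finite set $S'$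 of places of $K'$ containing all places above those of $S$ such that $(X\setminus D)(\mathcal{O}_{S'})$, computed over $K'$, is Zariski dense in $X_{K'}$. *)

theory Defs
  imports "HOL-Analysis.Analysis"
begin

definition number_field :: "complex set \<Rightarrow> bool" where
  "number_field K \<longleftrightarrow> 0 \<in> K \<and> 1 \<in> K \<and>
     (\<forall>x\<in>K. \<forall>y\<in>K. x + y \<in> K \<and> x * y \<in> K) \<and>
     (\<forall>x\<in>K. - x \<in> K \<and> inverse x \<in> K) \<and>
     (\<exists>B. finite B \<and> B \<subseteq> K \<and> (\<forall>x\<in>K. \<exists>q. x = (\<Sum>b\<in>B. of_rat (q b) * b)))"

text \<open>A finite place of F is a normalized discrete valuation on F (value 0 off F - {0}).\<close>
definition finite_place :: "complex set \<Rightarrow> (complex \<Rightarrow> int) \<Rightarrow> bool" where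
  "finite_place F v \<longleftrightarrow>
     (\<forall>x. x \<notin> F - {0} \<longrightarrow> v x = 0) \<and>
     (\<forall>x\<in>F - {0}. \<forall>y\<in>F - {0}. v (x * y) = v x + v y) \<and>
     (\<forall>x\<in>F - {0}. \<forall>y\<in>F - {0}. x + y \<noteq> 0 \<longrightarrow> min (v x) (v y) \<le> v (x + y)) \<and>
     (\<exists>x\<in>F - {0}. v x = 1)"

definition val_ring :: "complex set \<Rightarrow> (complex \<Rightarrow> int) \<Rightarrow> complex set" where
  "val_ring F v = {x \<in> F. x = 0 \<or> 0 \<le> v x}"

definition max_ideal :: "complex set \<Rightarrow> (complex \<Rightarrow> int) \<Rightarrow> complex set" where
  "max_ideal F v = {x \<in> F. x = 0 \<or> 0 < v x}"

definition lies_over :: "complex set \<Rightarrow> (complex \<Rightarrow> int) \<Rightarrow> complex set \<Rightarrow> (complex \<Rightarrow> int) \<Rightarrow> bool" where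
  "lies_over F' w F v \<longleftrightarrow> (\<exists>e::int. 0 < e \<and> (\<forall>x\<in>F - {0}. w x = e * v x))"

text \<open>Polynomials in X_0..X_3 as finitely supported coefficient functions on exponent vectors.\<close>
type_synonym poly4 = "nat ^ 4 \<Rightarrow> complex"

definition is_poly :: "poly4 \<Rightarrow> bool" where
  "is_poly c \<longleftrightarrow> finite {e. c e \<noteq> 0}"

definition peval :: "poly4 \<Rightarrow> complex ^ 4 \<Rightarrow> complex" where
  "peval c x = (\<Sum>e\<in>{e. c e \<noteq> 0}. c e * (\<Prod>i\<in>UNIV. x $ i ^ (e $ i)))"

definition homog :: "poly4 \<Rightarrow> bool" where
  "homog c \<longleftrightarrow> (\<exists>d. \<forall>e. c e \<noteq> 0 \<longrightarrow> (\<Sum>i\<in>UNIV. e $ i) = d)"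

definition coeffs_in :: "poly4 \<Rightarrow> complex set \<Rightarrow> bool" where
  "coeffs_in c R \<longleftrightarrow> (\<forall>e. c e \<in> R)"

text \<open>F-rational points of P^3: nonzero vectors with coordinates in F (representatives).\<close>
definition proj_point :: "complex set \<Rightarrow> complex ^ 4 \<Rightarrow> bool" where
  "proj_point F x \<longleftrightarrow> x \<noteq> 0 \<and> (\<forall>i. x $ i \<in> F)"

text \<open>Radical homogeneous ideal in F[X_0..X_3] of a closed subvariety, given by its
  (affine cone of) geometric points Z in C^4.\<close>
definition vanishing_ideal :: "complex set \<Rightarrow> (complex ^ 4) set \<Rightarrow> poly4 set" where
  "vanishing_ideal F Z = {c. is_poly c \<and> coeffs_in c F \<and> (\<forall>z\<in>Z. peval c z = 0)}"

definition reduces_to :: "complex set \<Rightarrow> (complex \<Rightarrow> int) \<Rightarrow> (complex ^ 4) set \<Rightarrow> complex ^ 4 \<Rightarrow> bool" where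
  "reduces_to F v Z x \<longleftrightarrow>
     (\<exists>l\<in>F - {0}.
        (\<forall>i. l * x $ i \<in> val_ring F v) \<and> (\<exists>i. l * x $ i \<noteq> 0 \<and> v (l * x $ i) = 0) \<and>
        (\<forall>c\<in>vanishing_ideal F Z. homog c \<and> coeffs_in c (val_ring F v) \<longrightarrow>
            peval c (l *s x) \<in> max_ideal F v))"

text \<open>S-integral points (S given by its finite places; archimedean places play no role).\<close>
definition integral_points :: "complex set \<Rightarrow> (complex \<Rightarrow> int) set \<Rightarrow> (complex ^ 4) set \<Rightarrow> (complex ^ 4) set" where
  "integral_points F S Z = {x. proj_point F x \<and>
       (\<forall>v. finite_place F v \<and> v \<notin> S \<longrightarrow> \<not> reduces_to F v Z x)}"

definition zariski_dense :: "complex set \<Rightarrow> (complex ^ 4) set \<Rightarrow> bool" where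
  "zariski_dense F A \<longleftrightarrow> (\<forall>c. is_poly c \<and> coeffs_in c F \<and> homog c \<and> c \<noteq> (\<lambda>_. 0) \<longrightarrow>
       (\<exists>x\<in>A. peval c x \<noteq> 0))"

definition potentially_dense :: "complex set \<Rightarrow> (complex \<Rightarrow> int) set \<Rightarrow> (complex ^ 4) set \<Rightarrow> bool" where
  "potentially_dense K S Z \<longleftrightarrow> (\<exists>K' S'. number_field K' \<and> K \<subseteq> K' \<and> finite S' \<and>
       (\<forall>w\<in>S'. finite_place K' w) \<and>
       (\<forall>v\<in>S. \<forall>w. finite_place K' w \<and> lies_over K' w K v \<longrightarrow> w \<in> S') \<and>
       zariski_dense K' (integral_points K' S' Z))"

definition lf :: "complex ^ 4 \<Rightarrow> complex ^ 4 \<Rightarrow> complex" where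
  "lf a x = (\<Sum>i\<in>UNIV. a $ i * x $ i)"

definition plane_cone :: "complex ^ 4 \<Rightarrow> (complex ^ 4) set" where
  "plane_cone a = {x. lf a x = 0}"

definition line_cone :: "complex ^ 4 \<Rightarrow> complex ^ 4 \<Rightarrow> (complex ^ 4) set" where
  "line_cone u w = {x. \<exists>s t. x = s *s u + t *s w}"

definition rational_vec :: "complex set \<Rightarrow> complex ^ 4 \<Rightarrow> bool" where
  "rational_vec K x \<longleftrightarrow> (\<forall>i. x $ i \<in> K)"

end

theory Submission
  imports Defs
begin

text \<open>
  No field extension is needed. Let y_i be the coordinates given by the four planes, and let S' be so
  large that 2 and all nonzero numbers attached to the configuration are units outside S'. For a line
  through p let E be the linear form in y_0, y_1, y_2 and G the one in y_0, y_1, y_3 that vanish on it.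
  A point with unit coordinates is integral as soon as, at every place outside S' and for every line,
  E or G is a unit.

  At most one plane contains p, say that of index 0. Take y_0 = 1, and let y_1, y_2 be constants times
  2^k and 2^(kn+1). Since 2^(kn+1) - 1 is congruent to 1 modulo 2^k - 1, the choice of the constants
  makes E coprime to p_1 y_0 - p_0 y_1. Now put y_3 = (p_3/p_1) y_1 2^m, where 2^m is congruent to 1
  modulo every prime dividing one of the numbers E. At such a prime G is congruent to a unit times
  p_1 y_0 - p_0 y_1, so G is a unit there. As k, then n, then m range over infinite sets, these points
  are Zariski dense.
\<close>

section \<open>Number fields and their finite places\<close>

locale numfield =
  fixes K :: "complex set"
  assumes number_field: "number_field K"
begin

lemma K_0 [simp]: "0 \<in> K" and K_1 [simp]: "1 \<in> K"
  and K_add: "x \<in> K \<Longrightarrow> y \<in> K \<Longrightarrow> x + y \<in> K"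
  and K_mult: "x \<in> K \<Longrightarrow> y \<in> K \<Longrightarrow> x * y \<in> K"
  and K_minus: "x \<in> K \<Longrightarrow> - x \<in> K"
  and K_inverse: "x \<in> K \<Longrightarrow> inverse x \<in> K"
  using number_field by (auto simp: number_field_def)

lemma K_diff: "x \<in> K \<Longrightarrow> y \<in> K \<Longrightarrow> x - y \<in> K"
  using K_add[OF _ K_minus, of x y] by simp

lemma K_divide: "x \<in> K \<Longrightarrow> y \<in> K \<Longrightarrow> x / y \<in> K"
  unfolding divide_inverse by (intro K_mult K_inverse)

lemma K_of_nat [simp]: "of_nat n \<in> K"
  by (induction n) (auto intro: K_add)

lemma K_of_int [simp]: "of_int n \<in> K"
  by (cases n rule: int_cases2) (auto intro: K_minus)

lemma K_numeral [simp]: "numeral n \<in> K"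
  using K_of_nat[of "numeral n"] by simp

lemma K_power: "x \<in> K \<Longrightarrow> x ^ n \<in> K"
  by (induction n) (auto intro: K_mult)

lemma K_sum: "(\<And>i. i \<in> A \<Longrightarrow> f i \<in> K) \<Longrightarrow> sum f A \<in> K"
  by (induction A rule: infinite_finite_induct) (auto intro: K_add)

lemma K_prod: "(\<And>i. i \<in> A \<Longrightarrow> f i \<in> K) \<Longrightarrow> prod f A \<in> K"
  by (induction A rule: infinite_finite_induct) (auto intro: K_mult)

lemmas K_closed = K_add K_mult K_minus K_inverse K_diff K_divide K_power

text \<open>A finite spanning set over the rationals bounds the size of independent sets, and
  clearing denominators makes the coefficients integers. Relations are indexed by \<open>T\<close>
  and not by the values of \<open>f\<close>, so values may repeat. The finiteness results on places
  below all go back to this lemma.\<close>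

lemma exists_int_relation:
  "\<exists>n. \<forall>(T :: 'b set) f. finite T \<longrightarrow> card T > n \<longrightarrow> f ` T \<subseteq> K \<longrightarrow>
       (\<exists>c :: 'b \<Rightarrow> int. (\<exists>t\<in>T. c t \<noteq> 0) \<and> (\<Sum>t\<in>T. of_int (c t) * f t) = 0)"
proof -
  interpret Q: vector_space "\<lambda>q (x::complex). of_rat q * x"
    by unfold_locales (auto simp: algebra_simps of_rat_add of_rat_mult)
  obtain B where B: "finite B" "\<forall>x\<in>K. \<exists>q. x = (\<Sum>b\<in>B. of_rat (q b) * b)"
    using number_field by (auto simp: number_field_def)
  have span: "K \<subseteq> Q.span B"
  proof
    fix x assume "x \<in> K"
    then obtain q where "x = (\<Sum>b\<in>B. of_rat (q b) * b)" using B by blast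
    then show "x \<in> Q.span B"
      by (simp only:) (intro Q.span_sum Q.span_scale Q.span_base)
  qed
  show ?thesis
  proof (intro exI[of _ "card B"] allI impI)
    fix T :: "'b set" and f
    assume T: "finite T" "card T > card B" "f ` T \<subseteq> K"
    have "\<exists>q :: 'b \<Rightarrow> rat. (\<exists>t\<in>T. q t \<noteq> 0) \<and> (\<Sum>t\<in>T. of_rat (q t) * f t) = 0"
    proof (cases "inj_on f T")
      case True
      have "Q.dependent (f ` T)"
      proof (rule ccontr)
        assume "\<not> ?thesis"
        then have "card (f ` T) \<le> card B"
          using Q.independent_span_bound[OF B(1)] T(3) span by blast
        then show False using T(2) card_image[OF True] by simp
      qed
      then obtain q where q: "\<exists>x\<in>f ` T. q x \<noteq> 0" "(\<Sum>x\<in>f ` T. of_rat (q x) * x) = 0"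
        using T(1) by (subst (asm) Q.dependent_finite) auto
      show ?thesis
        using q by (intro exI[of _ "q \<circ> f"]) (auto simp: sum.reindex[OF True] o_def)
    next
      case False
      then obtain s t where st: "s \<in> T" "t \<in> T" "s \<noteq> t" "f s = f t"
        by (auto simp: inj_on_def)
      \<comment> \<open>Equal values at two distinct indices satisfy a relation with coefficients 1
        and -1.\<close>
      let ?q = "\<lambda>x. if x = s then 1 else if x = t then - 1 else (0 :: rat)"
      have "(\<Sum>x\<in>T. of_rat (?q x) * f x) = (\<Sum>x\<in>{s, t}. of_rat (?q x) * f x)"
        using T(1) st by (intro sum.mono_neutral_right) auto
      also have "\<dots> = 0" using st by simp
      finally show ?thesis using st by (intro exI[of _ ?q]) auto
    qed
    then obtain q :: "'b \<Rightarrow> rat" where q: "\<exists>t\<in>T. q t \<noteq> 0" "(\<Sum>t\<in>T. of_rat (q t) * f t) = 0"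
      by blast
    define d where "d t = snd (quotient_of (q t))" for t
    define D where "D = (\<Prod>t\<in>T. d t)"
    have dpos: "d t > 0" for t by (simp add: d_def quotient_of_denom_pos')
    then have D: "D > 0" unfolding D_def by (intro prod_pos) auto
    have "\<exists>z::int. q t * of_int D = of_int z" if "t \<in> T" for t
    proof -
      obtain e where e: "D = d t * e"
        using dvd_prodI[OF T(1) \<open>t \<in> T\<close>, of d] by (auto simp: D_def)
      have "q t = of_int (fst (quotient_of (q t))) / of_int (d t)"
        unfolding d_def by (rule quotient_of_div) simp
      then have "q t * of_int D = of_int (fst (quotient_of (q t)) * e)"
        using dpos[of t] by (simp add: e field_simps)
      then show ?thesis by blast
    qed
    then obtain z :: "'b \<Rightarrow> int" where z: "\<And>t. t \<in> T \<Longrightarrow> q t * of_int D = of_int (z t)" by metis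
    have "(\<Sum>t\<in>T. of_int (z t) * f t) = (\<Sum>t\<in>T. of_rat (q t * of_int D) * f t)"
      by (intro sum.cong) (auto simp: z)
    also have "\<dots> = of_int D * (\<Sum>t\<in>T. of_rat (q t) * f t)"
      by (simp add: sum_distrib_left of_rat_mult algebra_simps)
    finally have "(\<Sum>t\<in>T. of_int (z t) * f t) = 0" using q by simp
    moreover have "\<exists>t\<in>T. z t \<noteq> 0" using q(1) D z by force
    ultimately show "\<exists>c :: 'b \<Rightarrow> int. (\<exists>t\<in>T. c t \<noteq> 0) \<and> (\<Sum>t\<in>T. of_int (c t) * f t) = 0"
      by blast
  qed
qed

end

section \<open>Valuation ring and maximal ideal of a finite place\<close>

locale place = numfield +
  fixes v :: "complex \<Rightarrow> int"
  assumes finite_place: "finite_place K v"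
begin

abbreviation "R \<equiv> val_ring K v"
abbreviation "M \<equiv> max_ideal K v"

lemma val_mult: "x \<in> K \<Longrightarrow> x \<noteq> 0 \<Longrightarrow> y \<in> K \<Longrightarrow> y \<noteq> 0 \<Longrightarrow> v (x * y) = v x + v y"
  and val_add: "x \<in> K \<Longrightarrow> x \<noteq> 0 \<Longrightarrow> y \<in> K \<Longrightarrow> y \<noteq> 0 \<Longrightarrow> x + y \<noteq> 0 \<Longrightarrow> min (v x) (v y) \<le> v (x + y)"
  and val_0 [simp]: "v 0 = 0"
  and ex_uniformizer: "\<exists>x\<in>K. x \<noteq> 0 \<and> v x = 1"
  using finite_place by (auto simp: finite_place_def)

lemma val_1 [simp]: "v 1 = 0"
  using val_mult[of 1 1] by simp

lemma val_minus [simp]: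
  assumes "x \<in> K" shows "v (- x) = v x"
proof (cases "x = 0")
  case False
  have "v (- 1) = 0" using val_mult[of "- 1" "- 1"] by (simp add: K_minus)
  then show ?thesis using val_mult[of "- 1" x] False assms by (simp add: K_minus)
qed simp

lemma val_inverse:
  assumes "x \<in> K" shows "v (inverse x) = - v x"
  using val_mult[of x "inverse x"] assms by (cases "x = 0") (auto simp: K_inverse)

lemma val_divide: "x \<in> K \<Longrightarrow> x \<noteq> 0 \<Longrightarrow> y \<in> K \<Longrightarrow> y \<noteq> 0 \<Longrightarrow> v (x / y) = v x - v y"
  unfolding divide_inverse by (simp add: val_mult val_inverse K_inverse)

lemma val_power: "x \<in> K \<Longrightarrow> x \<noteq> 0 \<Longrightarrow> v (x ^ n) = int n * v x"
  by (induction n) (auto simp: val_mult K_power algebra_simps)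

lemma val_add_eq:
  assumes "x \<in> K" "x \<noteq> 0" "y \<in> K" "y \<noteq> 0" "v x < v y"
  shows "x + y \<noteq> 0" "v (x + y) = v x"
proof -
  show *: "x + y \<noteq> 0"
    using assms val_minus[of y] by (auto simp: add_eq_0_iff2)
  show "v (x + y) = v x"
    using val_add[of x y] val_add[of "x + y" "- y"] assms * by (auto simp: K_closed)
qed

text \<open>Consequently \<open>z / (1 + z)\<close> has value 0 at the poles of \<open>z\<close> and
  keeps the value of \<open>z\<close> at its zeros. The approximating elements below are built this
  way.\<close>

lemma val_one_plus:
  assumes "z \<in> K" "z \<noteq> 0" "v z \<noteq> 0"
  shows "1 + z \<noteq> 0" "v (1 + z) = min 0 (v z)"
  using val_add_eq[of 1 z] val_add_eq[of z 1] assms by (cases "v z > 0"; auto simp: add.commute)+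

lemma R_in_K: "x \<in> R \<Longrightarrow> x \<in> K" and M_in_O: "x \<in> M \<Longrightarrow> x \<in> R"
  and R_0 [simp]: "0 \<in> R" and M_0 [simp]: "0 \<in> M"
  and R_1 [simp]: "1 \<in> R" and M_1 [simp]: "1 \<notin> M"
  by (auto simp: val_ring_def max_ideal_def)

lemma R_add: "x \<in> R \<Longrightarrow> y \<in> R \<Longrightarrow> x + y \<in> R"
  using val_add[of x y] by (cases "x = 0"; cases "y = 0"; cases "x + y = 0") (auto simp: val_ring_def K_closed)

lemma R_mult: "x \<in> R \<Longrightarrow> y \<in> R \<Longrightarrow> x * y \<in> R"
  by (cases "x = 0"; cases "y = 0") (auto simp: val_ring_def K_closed val_mult)

lemma R_minus: "x \<in> R \<Longrightarrow> - x \<in> R"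
  by (auto simp: val_ring_def K_closed)

lemma R_diff: "x \<in> R \<Longrightarrow> y \<in> R \<Longrightarrow> x - y \<in> R"
  using R_add[OF _ R_minus, of x y] by simp

lemma R_of_nat [simp]: "of_nat n \<in> R"
  by (induction n) (auto intro: R_add)

lemma R_of_int [simp]: "of_int n \<in> R"
  by (cases n rule: int_cases2) (auto intro: R_minus)

lemma R_numeral [simp]: "numeral n \<in> R"
  using R_of_nat[of "numeral n"] by simp

lemma R_power: "x \<in> R \<Longrightarrow> x ^ n \<in> R"
  by (induction n) (auto intro: R_mult)

lemma R_sum: "(\<And>i. i \<in> A \<Longrightarrow> f i \<in> R) \<Longrightarrow> sum f A \<in> R"
  by (induction A rule: infinite_finite_induct) (auto intro: R_add)

lemmas R_closed = R_add R_mult R_minus R_diff R_power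

lemma M_add: "x \<in> M \<Longrightarrow> y \<in> M \<Longrightarrow> x + y \<in> M"
  using val_add[of x y] by (cases "x = 0"; cases "y = 0"; cases "x + y = 0") (auto simp: max_ideal_def K_closed)

lemma M_mult: "x \<in> R \<Longrightarrow> y \<in> M \<Longrightarrow> x * y \<in> M" "y \<in> M \<Longrightarrow> x \<in> R \<Longrightarrow> y * x \<in> M"
  by (cases "x = 0"; cases "y = 0"; auto simp: val_ring_def max_ideal_def K_closed val_mult)+

lemma M_minus: "x \<in> M \<Longrightarrow> - x \<in> M"
  by (auto simp: max_ideal_def K_closed)

lemma M_diff: "x \<in> M \<Longrightarrow> y \<in> M \<Longrightarrow> x - y \<in> M"
  using M_add[OF _ M_minus, of x y] by simp

lemma M_sum: "(\<And>i. i \<in> A \<Longrightarrow> f i \<in> M) \<Longrightarrow> sum f A \<in> M"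
  by (induction A rule: infinite_finite_induct) (auto intro: M_add)

lemma M_prime: "x \<in> R \<Longrightarrow> y \<in> R \<Longrightarrow> x * y \<in> M \<Longrightarrow> x \<in> M \<or> y \<in> M"
  by (cases "x = 0"; cases "y = 0"; auto simp: val_ring_def max_ideal_def K_closed val_mult)+

lemma M_power: "x \<in> R \<Longrightarrow> x ^ n \<in> M \<Longrightarrow> x \<in> M"
  by (induction n) (auto dest: M_prime[rotated 2] simp: R_closed)

lemma unit_iff: "x \<in> R - M \<longleftrightarrow> x \<in> K \<and> x \<noteq> 0 \<and> v x = 0"
  by (auto simp: val_ring_def max_ideal_def)

lemma M_prod: "finite A \<Longrightarrow> (\<And>i. i \<in> A \<Longrightarrow> f i \<in> R - M) \<Longrightarrow> prod f A \<in> R - M"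
  by (induction A rule: finite_induct) (auto dest: M_prime[rotated 2] intro: R_mult)

text \<open>By Bezout, 1 would otherwise lie in \<open>M\<close>.\<close>

lemma coprime_int_not_M:
  assumes "of_int p \<in> M" "coprime p n" shows "of_int n \<notin> M"
proof
  assume n: "of_int n \<in> M"
  obtain s t where "s * p + t * n = 1" using bezout_int[of p n] assms(2) by auto
  then have "of_int s * of_int p + of_int t * of_int n = (1 :: complex)"
    by (metis of_int_1 of_int_add of_int_mult)
  then show False using n assms(1) by (metis M_1 M_add M_mult(1) R_of_int)
qed

end

section \<open>Independence of finite places and finiteness of the nonunit places\<close>

context numfield
begin

lemma place_of_finite_place: "finite_place K v \<Longrightarrow> place K v"
  by unfold_locales

text \<open>Neither valuation ring contains the other: an inclusion would make the two valuations
  proportional, and both being normalized, equal. A quotient of two witnesses of non-inclusion then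
  has a pole at one place and a zero at the other.\<close>

lemma separate_two_places:
  assumes "finite_place K v" "finite_place K w" "v \<noteq> w"
  shows "\<exists>z\<in>K - {0}. v z < 0 \<and> w z > 0"
proof -
  have not_le: "\<exists>x\<in>K - {0}. v x \<ge> 0 \<and> w x < 0"
    if "finite_place K v" "finite_place K w" "v \<noteq> w" for v w
  proof (rule ccontr)
    interpret v: place K v using that by (rule_tac place_of_finite_place)
    interpret w: place K w using that by (rule_tac place_of_finite_place)
    assume "\<not> ?thesis"
    then have le: "\<And>x. x \<in> K \<Longrightarrow> x \<noteq> 0 \<Longrightarrow> v x \<ge> 0 \<Longrightarrow> w x \<ge> 0" by force
    \<comment> \<open>The assumed inclusion of valuation rings, applied to \<open>x\<close> and to
      its inverse, turns units at \<open>v\<close> into units at \<open>w\<close>.\<close>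
    have zero: "w x = 0" if "x \<in> K" "x \<noteq> 0" "v x = 0" for x
      using le[of x] le[of "inverse x"] that by (simp add: K_inverse v.val_inverse w.val_inverse)
    obtain t where t: "t \<in> K" "t \<noteq> 0" "v t = 1" using v.ex_uniformizer by blast
    \<comment> \<open>Removing a power of the uniformizer \<open>t\<close> leaves a unit at
      \<open>v\<close>, hence at \<open>w\<close>.\<close>
    have *: "w x = v x * w t" if x: "x \<in> K" "x \<noteq> 0" for x
    proof (cases "v x \<ge> 0")
      case True
      have "w (x / t ^ nat (v x)) = 0"
        using x t True by (intro zero) (auto simp: K_closed v.val_divide v.val_power)
      then show ?thesis using x t True by (simp add: w.val_divide w.val_power K_closed)
    next
      case False
      have "w (x * t ^ nat (- v x)) = 0"
        using x t False by (intro zero) (auto simp: K_closed v.val_mult v.val_power)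
      then show ?thesis using x t False by (simp add: w.val_mult w.val_power K_closed)
    qed
    obtain s where s: "s \<in> K" "s \<noteq> 0" "w s = 1" using w.ex_uniformizer by blast
    have "w t \<ge> 0" using le[of t] t by simp
    moreover have "v s * w t = 1" using *[of s] s by simp
    ultimately have "w t = 1" by (metis zmult_eq_1_iff order.antisym zero_le_one not_one_le_zero
        neg_0_le_iff_le)
    then have "w x = v x" for x
      using * that(1,2) by (cases "x \<in> K - {0}") (auto simp: finite_place_def)
    then show False using that(3) by auto
  qed
  obtain x where x: "x \<in> K - {0}" "v x \<ge> 0" "w x < 0" using not_le[OF assms] by blast
  obtain y where y: "y \<in> K - {0}" "w y \<ge> 0" "v y < 0" using not_le[OF assms(2,1)] assms(3) by blast
  show ?thesis
  proof (intro bexI[of _ "y / x"] conjI)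
    show "v (y / x) < 0" "w (y / x) > 0"
      using x y assms by (simp_all add: place.val_divide[OF place_of_finite_place])
  qed (use x y in \<open>auto simp: K_divide\<close>)
qed

text \<open>The approximation argument of Artin and Whaples.\<close>

lemma separate_places:
  assumes "finite T" "finite_place K v" "\<And>w. w \<in> T \<Longrightarrow> finite_place K w" "v \<notin> T"
  shows "\<exists>z\<in>K - {0}. v z < 0 \<and> (\<forall>w\<in>T. w z > 0)"
  using assms
proof (induction T rule: finite_induct)
  case empty
  interpret v: place K v using empty by (rule_tac place_of_finite_place)
  obtain t where "t \<in> K" "t \<noteq> 0" "v t = 1" using v.ex_uniformizer by blast
  then show ?case by (intro bexI[of _ "inverse t"]) (auto simp: K_inverse v.val_inverse)
next
  case (insert u T)
  interpret v: place K v using insert by (rule_tac place_of_finite_place)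
  interpret u: place K u using insert by (rule_tac place_of_finite_place) auto
  have pl: "place K w" if "w \<in> T" for w using insert that by (rule_tac place_of_finite_place) auto
  obtain z where z: "z \<in> K" "z \<noteq> 0" "v z < 0" "\<And>w. w \<in> T \<Longrightarrow> w z > 0"
    using insert by auto
  obtain y where y: "y \<in> K" "y \<noteq> 0" "v y < 0" "u y > 0"
    using separate_two_places[of v u] insert by auto
  \<comment> \<open>The exponent exceeds every \<open>\<bar>w y\<bar>\<close>, and
    \<open>w z\<close> is at least 1 on \<open>T\<close>, so \<open>z ^ k\<close> outweighs any pole
    of \<open>y\<close> there.\<close>
  define k where "k = Suc (nat (\<Sum>w\<in>T. \<bar>w y\<bar>))"
  have k: "int k * w z + w y > 0" if "w \<in> T" for w
  proof -
    have "\<bar>w y\<bar> \<le> (\<Sum>w\<in>T. \<bar>w y\<bar>)" using that insert(1) by (intro member_le_sum) auto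
    then have "\<bar>w y\<bar> < int k" by (simp add: k_def)
    also have "int k * 1 \<le> int k * w z" using z(4)[OF that] by (intro mult_left_mono) auto
    finally show ?thesis by simp
  qed
  have k0: "k > 0" by (simp add: k_def)
  have zk: "z ^ k \<in> K" "z ^ k \<noteq> 0" using z by (auto simp: K_power)
  show ?case
  proof (cases "u z \<ge> 0")
    case True
    \<comment> \<open>If \<open>z\<close> has no pole at \<open>u\<close>, the zero of
      \<open>y\<close> decides at \<open>u\<close>, while \<open>z ^ k\<close> decides on
      \<open>T\<close>; at \<open>v\<close> both factors have a pole.\<close>
    have val: "w (z ^ k * y) = int k * w z + w y" if "place K w" for w
      using z y zk by (simp add: place.val_mult[OF that] place.val_power[OF that])
    have "v (z ^ k * y) < 0"
      using z y k0 by (simp add: val[OF v.place_axioms] add_neg_neg mult_pos_neg)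
    moreover have "u (z ^ k * y) > 0"
      using True y k0 by (simp add: val[OF u.place_axioms] add_nonneg_pos)
    moreover have "w (z ^ k * y) > 0" if "w \<in> T" for w
      using k[OF that] val[OF pl[OF that]] by simp
    ultimately show ?thesis using z y by (intro bexI[of _ "z ^ k * y"]) (auto simp: K_closed)
  next
    case False
    \<comment> \<open>Now \<open>z\<close> has poles at both \<open>u\<close> and \<open>v\<close>.
      The fraction is a unit at these two places, so \<open>y\<close> alone decides there; on
      \<open>T\<close> it has the same value as \<open>z ^ k\<close>.\<close>
    let ?x = "y * (z ^ k / (1 + z ^ k))"
    have ne: "1 + z ^ k \<noteq> 0"
      using v.val_one_plus[of "z ^ k"] zk z k0 by (simp add: v.val_power)
    have val: "w ?x = w y + int k * w z - min 0 (int k * w z)" if "place K w" "w z \<noteq> 0" for w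
    proof -
      have "w (1 + z ^ k) = min 0 (int k * w z)"
        using place.val_one_plus(2)[OF that(1) zk] that k0 z
        by (simp add: place.val_power[OF that(1)])
      then show ?thesis using z y zk ne
        by (simp add: place.val_mult[OF that(1)] place.val_divide[OF that(1)]
            place.val_power[OF that(1)] K_closed)
    qed
    have neg: "int k * w z \<le> 0" if "w z < 0" for w
      using that by (simp add: mult_nonneg_nonpos)
    have "v ?x < 0" using z y neg[of v] val[OF v.place_axioms] by simp
    moreover have "u ?x > 0" using False y neg[of u] val[OF u.place_axioms] by simp
    moreover have "w ?x > 0" if "w \<in> T" for w
      using k[OF that] z(4)[OF that] val[OF pl[OF that]] by simp
    moreover have "?x \<in> K - {0}" using z y ne by (auto simp: K_closed)
    ultimately show ?thesis by (intro bexI[of _ ?x]) auto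
  qed
qed

text \<open>For each of too many places choose an element that is a unit there and lies in the
  maximal ideals of the others. An integer relation among these elements may be assumed to have a
  coefficient prime to \<open>p\<close>; modulo the maximal ideal of the corresponding place only
  that term survives, and it is a unit.\<close>

lemma finite_places_above_prime:
  assumes "prime (p :: int)"
  shows "finite {v. finite_place K v \<and> of_int p \<in> max_ideal K v}" (is "finite ?A")
proof (rule ccontr)
  assume inf: "infinite ?A"
  obtain n :: nat where n: "\<forall>(T :: (complex \<Rightarrow> int) set) f. finite T \<longrightarrow> card T > n \<longrightarrow> f ` T \<subseteq> K \<longrightarrow>
       (\<exists>c :: (complex \<Rightarrow> int) \<Rightarrow> int. (\<exists>t\<in>T. c t \<noteq> 0) \<and> (\<Sum>t\<in>T. of_int (c t) * f t) = 0)"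
    using exists_int_relation[where 'b = "complex \<Rightarrow> int"] by (elim exE)
  obtain T where T: "T \<subseteq> ?A" "finite T" "card T = Suc n"
    using infinite_arbitrarily_large[OF inf] by blast
  have "\<exists>x\<in>K - {0}. v x = 0 \<and> (\<forall>w\<in>T - {v}. w x > 0)" if v: "v \<in> T" for v
  proof -
    have pl: "place K w" if "w \<in> T" for w using T(1) that by (intro place_of_finite_place) auto
    obtain z where z: "z \<in> K - {0}" "v z < 0" "\<And>w. w \<in> T - {v} \<Longrightarrow> w z > 0"
      using separate_places[of "T - {v}" v] T v by auto
    have "1 + z \<noteq> 0" using place.val_one_plus(1)[OF pl[OF v]] z by simp
    moreover have "w (1 + z) = min 0 (w z)" if "w \<in> T" for w
      using place.val_one_plus(2)[OF pl[OF that]] z by (cases "w = v") (use that in force)+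
    ultimately have val: "w (z / (1 + z)) = w z - min 0 (w z)" if "w \<in> T" for w
      using place.val_divide[OF pl[OF that]] z that by (auto simp: K_closed)
    show ?thesis
    proof (intro bexI[of _ "z / (1 + z)"] conjI ballI)
      show "v (z / (1 + z)) = 0" using val[OF v] z(2) by simp
      show "w (z / (1 + z)) > 0" if "w \<in> T - {v}" for w using val[of w] z(3)[OF that] that by simp
    qed (use z \<open>1 + z \<noteq> 0\<close> in \<open>auto simp: K_closed\<close>)
  qed
  then obtain x where x: "\<And>v. v \<in> T \<Longrightarrow> x v \<in> K - {0}" "\<And>v. v \<in> T \<Longrightarrow> v (x v) = 0"
    "\<And>v w. v \<in> T \<Longrightarrow> w \<in> T \<Longrightarrow> w \<noteq> v \<Longrightarrow> w (x v) > 0"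
    by (metis Diff_iff singletonD)
  obtain c where c: "\<exists>t\<in>T. c t \<noteq> 0" "(\<Sum>t\<in>T. of_int (c t) * x t) = 0"
    using n[rule_format, of T x] T x by (auto simp: image_subset_iff)
  \<comment> \<open>Dividing by the common divisor leaves coefficients that are not all divisible by
    \<open>p\<close>.\<close>
  define g where "g = Gcd (c ` T)"
  have g0: "g \<noteq> 0" using c(1) by (auto simp: g_def)
  define d where "d t = c t div g" for t
  have d: "c t = g * d t" if "t \<in> T" for t
    using that by (simp add: d_def g_def)
  have "(\<Sum>t\<in>T. of_int (c t) * x t) = of_int g * (\<Sum>t\<in>T. of_int (d t) * x t)"
    unfolding sum_distrib_left by (intro sum.cong refl) (simp only: d of_int_mult mult.assoc)
  then have d_rel: "(\<Sum>t\<in>T. of_int (d t) * x t) = 0" using c(2) g0 by simp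
  have "\<exists>v\<in>T. \<not> p dvd d v"
  proof (rule ccontr)
    assume "\<not> ?thesis"
    then have "g * p dvd Gcd (c ` T)"
      by (intro Gcd_greatest) (auto simp: d)
    then have "g * p dvd g" by (simp only: g_def)
    then show False using g0 assms by (auto simp: not_prime_unit)
  qed
  then obtain v where v: "v \<in> T" "\<not> p dvd d v" by blast
  interpret v: place K v using T(1) v by (intro place_of_finite_place) auto
  have "of_int p \<in> v.M" using T v by auto
  then have "of_int (d v) \<notin> v.M"
    using v(2) assms by (intro v.coprime_int_not_M[of p]) (auto intro: prime_imp_coprime)
  moreover have "x v \<in> v.R - v.M" using x[of v] v by (subst v.unit_iff) auto
  moreover have "(\<Sum>t\<in>T - {v}. of_int (d t) * x t) \<in> v.M"
    using x v by (intro v.M_sum v.M_mult) (auto simp: max_ideal_def)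
  then have "of_int (d v) * x v \<in> v.M"
    using d_rel v.M_minus by (simp add: sum.remove[OF T(2) v(1)] add_eq_0_iff2)
  ultimately show False using v.M_prime[of "of_int (d v)" "x v"] by auto
qed

text \<open>Some integer relation holds between powers of \<open>x\<close>. After division by its
  lowest power, the lowest coefficient is a combination of positive powers of \<open>x\<close>,
  hence lies in every maximal ideal that contains \<open>x\<close>. This integer stands in for the
  norm.\<close>

lemma divides_integer:
  assumes "x \<in> K" "x \<noteq> 0"
  obtains N :: int where "N \<noteq> 0" "\<And>v. finite_place K v \<Longrightarrow> x \<in> max_ideal K v \<Longrightarrow> of_int N \<in> max_ideal K v"
proof -
  obtain n :: nat where n: "\<forall>(T :: nat set) f. finite T \<longrightarrow> card T > n \<longrightarrow> f ` T \<subseteq> K \<longrightarrow>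
       (\<exists>c :: nat \<Rightarrow> int. (\<exists>t\<in>T. c t \<noteq> 0) \<and> (\<Sum>t\<in>T. of_int (c t) * f t) = 0)"
    using exists_int_relation[where 'b = nat] by (elim exE)
  obtain c :: "nat \<Rightarrow> int" where c: "\<exists>t\<in>{..n}. c t \<noteq> 0" "(\<Sum>t\<in>{..n}. of_int (c t) * x ^ t) = 0"
    using n[rule_format, of "{..n}" "\<lambda>t. x ^ t"] assms by (auto simp: K_power image_subset_iff)
  define m where "m = (LEAST t. c t \<noteq> 0)"
  have m: "c m \<noteq> 0" "\<And>t. t < m \<Longrightarrow> c t = 0"
    using c(1) unfolding m_def by (metis (mono_tags) LeastI, metis (mono_tags) not_less_Least)
  have mn: "m \<le> n" using c(1) m(2) by (metis atMost_iff leI le_less_trans)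
  have "(\<Sum>t\<in>{..n}. of_int (c t) * x ^ t) = (\<Sum>t\<in>{m..n}. of_int (c t) * x ^ t)"
    using m(2) by (intro sum.mono_neutral_right) auto
  also have "\<dots> = (\<Sum>t\<in>{m..n}. x ^ m * (of_int (c t) * x ^ (t - m)))"
    by (intro sum.cong) (auto simp: power_add[symmetric])
  also have "\<dots> = x ^ m * (\<Sum>t\<in>{m..n}. of_int (c t) * x ^ (t - m))"
    by (simp add: sum_distrib_left)
  also have "{m..n} = insert m {m<..n}" using mn by auto
  finally have eq: "of_int (c m) = - (\<Sum>t\<in>{m<..n}. of_int (c t) * x ^ (t - m))"
    using c(2) assms by (simp add: add_eq_0_iff2)
  show ?thesis
  proof (rule that[OF m(1)])
    fix v assume "finite_place K v" and x: "x \<in> max_ideal K v"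
    then interpret v: place K v by (rule_tac place_of_finite_place)
    have "x ^ (t - m) \<in> v.M" if "t > m" for t
    proof -
      obtain s where "t - m = Suc s" using \<open>t > m\<close> by (cases "t - m") auto
      then show ?thesis using x by (simp add: v.M_mult v.R_power v.M_in_O)
    qed
    then show "of_int (c m) \<in> v.M" unfolding eq by (intro v.M_minus v.M_sum v.M_mult) auto
  qed
qed

text \<open>A nonzero value means that \<open>x\<close> or its inverse lies in the maximal ideal.
  Then so does a fixed nonzero integer, and hence one of its finitely many prime factors.\<close>

lemma finite_nonunit_places:
  "finite {v. finite_place K v \<and> v x \<noteq> 0}"
proof (cases "x \<in> K - {0}")
  case False
  then have "{v. finite_place K v \<and> v x \<noteq> 0} = {}" by (auto simp: finite_place_def)
  then show ?thesis by (simp only: finite.emptyI)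
next
  case True
  have M: "finite {v. finite_place K v \<and> x \<in> max_ideal K v}" if x: "x \<in> K" "x \<noteq> 0" for x
  proof -
    obtain N :: int where N: "N \<noteq> 0" "\<And>v. finite_place K v \<Longrightarrow> x \<in> max_ideal K v \<Longrightarrow> of_int N \<in> max_ideal K v"
      using divides_integer[OF x] by blast
    have "\<exists>p\<in>prime_factors N. of_int p \<in> max_ideal K v" if "finite_place K v" "of_int N \<in> max_ideal K v" for v
    proof (rule ccontr)
      interpret v: place K v using that by (rule_tac place_of_finite_place)
      assume "\<not> ?thesis"
      then have *: "(of_int p :: complex) \<in> v.R - v.M" if "p \<in> prime_factors N" for p using that by auto
      have "\<bar>N\<bar> = (\<Prod>p\<in>prime_factors N. p ^ multiplicity p N)"
        using N(1) by (simp add: prod_prime_factors)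
      then have "of_int \<bar>N\<bar> = (\<Prod>p\<in>prime_factors N. (of_int p :: complex) ^ multiplicity p N)"
        by simp
      also have "\<dots> \<in> v.R - v.M"
        using * by (intro v.M_prod) (auto intro: v.R_power dest: v.M_power[rotated])
      finally show False using that(2) v.M_minus by (auto simp: abs_if split: if_splits)
    qed
    then have "{v. finite_place K v \<and> x \<in> max_ideal K v} \<subseteq>
       (\<Union>p\<in>prime_factors N. {v. finite_place K v \<and> of_int p \<in> max_ideal K v})"
      using N(2) by blast
    moreover have "finite \<dots>"
      by (intro finite_UN_I finite_places_above_prime) auto
    ultimately show ?thesis by (rule finite_subset)
  qed
  have "{v. finite_place K v \<and> v x \<noteq> 0} \<subseteq>
    {v. finite_place K v \<and> x \<in> max_ideal K v} \<union> {v. finite_place K v \<and> inverse x \<in> max_ideal K v}"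
    using True by (auto simp: max_ideal_def K_inverse place.val_inverse[OF place_of_finite_place])
  then show ?thesis
    by (rule finite_subset) (use True in \<open>auto intro!: M simp: K_inverse\<close>)
qed

text \<open>Replace the elements of \<open>X\<close> by integers and let \<open>D\<close> be the
  product of these. Two powers of 2 agree modulo \<open>D\<close> by the pigeonhole principle. Since
  \<open>D\<close> may be even, only \<open>2 ^ i * (2 ^ (j - i) - 1)\<close> is known to be
  divisible by \<open>D\<close>; the factor \<open>2 ^ i\<close> cancels where 2 is a unit.\<close>

lemma power_of_two_cong_one:
  assumes "finite X" "X \<subseteq> K" "0 \<notin> X"
  obtains m :: nat where "m > 0"
    "\<And>v x. finite_place K v \<Longrightarrow> v 2 = 0 \<Longrightarrow> x \<in> X \<Longrightarrow> x \<in> max_ideal K v \<Longrightarrow> 2 ^ m - 1 \<in> max_ideal K v"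
proof -
  have "\<exists>N::int. N \<noteq> 0 \<and> (\<forall>v. finite_place K v \<longrightarrow> x \<in> max_ideal K v \<longrightarrow> of_int N \<in> max_ideal K v)"
    if "x \<in> X" for x
    using divides_integer[of x] assms that by (metis subsetD)
  then obtain N :: "complex \<Rightarrow> int" where N: "\<And>x. x \<in> X \<Longrightarrow> N x \<noteq> 0"
    "\<And>x v. x \<in> X \<Longrightarrow> finite_place K v \<Longrightarrow> x \<in> max_ideal K v \<Longrightarrow> of_int (N x) \<in> max_ideal K v"
    by metis
  define D where "D = (\<Prod>x\<in>X. N x)"
  have D: "D \<noteq> 0" using assms N by (auto simp: D_def)
  have "(\<lambda>i::nat. 2 ^ i mod D) ` UNIV \<subseteq> {- \<bar>D\<bar>..\<bar>D\<bar>}"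
  proof (intro subsetI, elim imageE)
    fix y and i :: nat assume "y = 2 ^ i mod D"
    then have "\<bar>y\<bar> < \<bar>D\<bar>" using D abs_mod_less by blast
    then show "y \<in> {- \<bar>D\<bar>..\<bar>D\<bar>}" by auto
  qed
  then have "finite (range (\<lambda>i::nat. 2 ^ i mod D))" by (rule finite_subset) simp
  then have "\<not> inj (\<lambda>i::nat. 2 ^ i mod D)" using finite_imageD by blast
  then obtain i j :: nat where ij: "i < j" "2 ^ i mod D = 2 ^ j mod D"
    unfolding inj_def by (metis nat_neq_iff)
  then have "D dvd 2 ^ j - 2 ^ i" by (metis mod_eq_dvd_iff)
  also have "2 ^ j - 2 ^ i = 2 ^ i * (2 ^ (j - i) - 1 :: int)"
    using ij(1) by (simp add: algebra_simps power_add[symmetric])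
  finally have dvd: "D dvd 2 ^ i * (2 ^ (j - i) - 1)" .
  show ?thesis
  proof (rule that[of "j - i"])
    fix v x assume v: "finite_place K v" "v 2 = 0" and x: "x \<in> X" "x \<in> max_ideal K v"
    interpret v: place K v using v by (rule_tac place_of_finite_place)
    have "N x dvd D" using x(1) assms(1) by (auto simp: D_def)
    then obtain e where "2 ^ i * (2 ^ (j - i) - 1) = N x * e" using dvd by (metis dvd_trans dvdE)
    then have "of_int (2 ^ i * (2 ^ (j - i) - 1)) = (of_int (N x * e) :: complex)" by simp
    also have "\<dots> \<in> v.M" using N(2)[OF x(1) v(1) x(2)] by (auto intro: v.M_mult)
    finally have *: "2 ^ i * (2 ^ (j - i) - 1) \<in> v.M" by simp
    have "(2::complex) \<in> v.R - v.M" using v by (subst v.unit_iff) simp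
    then have "2 ^ i \<notin> v.M" using v.M_power by blast
    then show "2 ^ (j - i) - 1 \<in> v.M"
      using v.M_prime[OF _ _ *] by (simp add: v.R_closed)
  qed (use ij in simp)
qed

end

section \<open>Polynomials in four variables\<close>

lemma peval_superset:
  assumes "finite F" "{e. c e \<noteq> 0} \<subseteq> F"
  shows "peval c x = (\<Sum>e\<in>F. c e * (\<Prod>i\<in>UNIV. x $ i ^ (e $ i)))"
  unfolding peval_def using assms by (intro sum.mono_neutral_left) auto

text \<open>Polynomials are represented by their functions, with the coefficient function hidden.
  Products of linear forms are then built from sums, scalings and multiplication by a variable, with
  no convolution of coefficients. The set \<open>R\<close> is later a valuation ring.\<close>

definition form_over :: "complex set \<Rightarrow> nat \<Rightarrow> (complex ^ 4 \<Rightarrow> complex) \<Rightarrow> bool" where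
  "form_over R d g \<longleftrightarrow> (\<exists>c. is_poly c \<and> coeffs_in c R \<and>
     (\<forall>e. c e \<noteq> 0 \<longrightarrow> (\<Sum>i\<in>UNIV. e $ i) = d) \<and> (\<forall>x. peval c x = g x))"

lemma form_over_one:
  assumes "0 \<in> R" "1 \<in> R" shows "form_over R 0 (\<lambda>_. 1)"
proof -
  let ?c = "\<lambda>e :: nat ^ 4. if e = 0 then 1 else 0 :: complex"
  have "is_poly ?c" by (simp add: is_poly_def)
  moreover have "peval ?c x = 1" for x by (subst peval_superset[of "{0}"]) auto
  moreover have "coeffs_in ?c R" using assms by (simp add: coeffs_in_def)
  moreover have "\<forall>e. ?c e \<noteq> 0 \<longrightarrow> (\<Sum>i\<in>UNIV. e $ i) = 0" by simp
  ultimately show ?thesis unfolding form_over_def by blast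
qed

lemma form_over_add:
  assumes "form_over R d g" "form_over R d h" and R: "\<And>x y. x \<in> R \<Longrightarrow> y \<in> R \<Longrightarrow> x + y \<in> R"
  shows "form_over R d (\<lambda>x. g x + h x)"
proof -
  obtain b where b: "is_poly b" "coeffs_in b R" "\<And>e. b e \<noteq> 0 \<Longrightarrow> (\<Sum>i\<in>UNIV. e $ i) = d"
    "\<And>x. peval b x = g x" using assms(1) by (auto simp: form_over_def)
  obtain c where c: "is_poly c" "coeffs_in c R" "\<And>e. c e \<noteq> 0 \<Longrightarrow> (\<Sum>i\<in>UNIV. e $ i) = d"
    "\<And>x. peval c x = h x" using assms(2) by (auto simp: form_over_def)
  let ?F = "{e. b e \<noteq> 0} \<union> {e. c e \<noteq> 0}" and ?s = "\<lambda>e. b e + c e"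
  have F: "finite ?F" using b c by (simp add: is_poly_def)
  have sub: "{e. ?s e \<noteq> 0} \<subseteq> ?F" by auto
  have "is_poly ?s" unfolding is_poly_def using F sub by (rule finite_subset[rotated])
  moreover have "coeffs_in ?s R" using b c R by (simp add: coeffs_in_def)
  moreover have "(\<Sum>i\<in>UNIV. e $ i) = d" if "?s e \<noteq> 0" for e
    using sub that b(3)[of e] c(3)[of e] by (cases "b e = 0") auto
  moreover have "peval ?s x = g x + h x" for x
    unfolding b(4)[symmetric] c(4)[symmetric]
    by (subst (1 2 3) peval_superset[OF F]) (auto simp: sum.distrib distrib_right)
  ultimately show ?thesis unfolding form_over_def by blast
qed

lemma form_over_scale:
  assumes "form_over R d g" "k \<in> R" and R: "\<And>x y. x \<in> R \<Longrightarrow> y \<in> R \<Longrightarrow> x * y \<in> R"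
  shows "form_over R d (\<lambda>x. k * g x)"
proof -
  obtain c where c: "is_poly c" "coeffs_in c R" "\<And>e. c e \<noteq> 0 \<Longrightarrow> (\<Sum>i\<in>UNIV. e $ i) = d"
    "\<And>x. peval c x = g x" using assms(1) by (auto simp: form_over_def)
  let ?s = "\<lambda>e. k * c e"
  have F: "finite {e. c e \<noteq> 0}" using c by (simp add: is_poly_def)
  have sub: "{e. ?s e \<noteq> 0} \<subseteq> {e. c e \<noteq> 0}" by auto
  have "is_poly ?s" unfolding is_poly_def using F sub by (rule finite_subset[rotated])
  moreover have "coeffs_in ?s R" using c R assms by (simp add: coeffs_in_def)
  moreover have "(\<Sum>i\<in>UNIV. e $ i) = d" if "?s e \<noteq> 0" for e using that c(3)[of e] by auto
  moreover have "peval ?s x = k * g x" for x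
    unfolding c(4)[symmetric]
    by (subst (1 2) peval_superset[OF F]) (auto simp: sum_distrib_left mult.assoc)
  ultimately show ?thesis unfolding form_over_def by blast
qed

lemma form_over_mult_var:
  assumes "form_over R d g" "0 \<in> R"
  shows "form_over R (Suc d) (\<lambda>x. x $ k * g x)"
proof -
  obtain c where c: "is_poly c" "coeffs_in c R" "\<And>e. c e \<noteq> 0 \<Longrightarrow> (\<Sum>i\<in>UNIV. e $ i) = d"
    "\<And>x. peval c x = g x" using assms(1) by (auto simp: form_over_def)
  \<comment> \<open>Multiplication by a variable shifts the exponent vectors by a unit
    vector.\<close>
  define sh where "sh e = e + axis k 1" for e :: "nat ^ 4"
  have inj: "inj sh" by (auto simp: inj_def sh_def)
  define s where "s e = (if e \<in> range sh then c (inv sh e) else 0)" for e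
  have s_sh: "s (sh e) = c e" for e using inj by (simp add: s_def)
  have supp: "{e. s e \<noteq> 0} = sh ` {e. c e \<noteq> 0}"
    using inj by (auto simp: s_def inj_eq split: if_splits)
  have F: "finite {e. c e \<noteq> 0}" using c by (simp add: is_poly_def)
  have "is_poly s" unfolding is_poly_def supp using F by simp
  moreover have "coeffs_in s R" using c assms(2) by (simp add: coeffs_in_def s_def)
  moreover have "(\<Sum>i\<in>UNIV. e $ i) = Suc d" if "s e \<noteq> 0" for e
  proof -
    obtain e' where e': "e = sh e'" "c e' \<noteq> 0" using \<open>s e \<noteq> 0\<close> supp by auto
    show ?thesis using c(3)[OF e'(2)] by (simp add: e' sh_def sum.distrib axis_def)
  qed
  moreover have "peval s x = x $ k * g x" for x
  proof -
    have mon: "(\<Prod>i\<in>UNIV. x $ i ^ (sh e $ i)) = x $ k * (\<Prod>i\<in>UNIV. x $ i ^ (e $ i))" for e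
    proof -
      have "(\<Prod>i\<in>UNIV. x $ i ^ (sh e $ i)) =
          (\<Prod>i\<in>UNIV. x $ i ^ (e $ i)) * (\<Prod>i\<in>UNIV. if i = k then x $ i else 1)"
        unfolding prod.distrib[symmetric] by (intro prod.cong) (auto simp: sh_def axis_def power_add)
      then show ?thesis by simp
    qed
    have "peval s x = (\<Sum>e\<in>{e. c e \<noteq> 0}. s (sh e) * (\<Prod>i\<in>UNIV. x $ i ^ (sh e $ i)))"
      unfolding peval_def supp using inj by (simp add: sum.reindex inj_on_subset o_def)
    also have "\<dots> = x $ k * peval c x"
      by (simp add: s_sh mon peval_def sum_distrib_left mult_ac)
    finally show ?thesis by (simp add: c)
  qed
  ultimately show ?thesis unfolding form_over_def by blast
qed

lemma form_over_mult_lf: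
  assumes g: "form_over R d g" and h: "\<And>i. h $ i \<in> R" and R0: "0 \<in> R"
    and R: "\<And>x y. x \<in> R \<Longrightarrow> y \<in> R \<Longrightarrow> x + y \<in> R" "\<And>x y. x \<in> R \<Longrightarrow> y \<in> R \<Longrightarrow> x * y \<in> R"
  shows "form_over R (Suc d) (\<lambda>x. lf h x * g x)"
proof -
  have "form_over R (Suc d) (\<lambda>x. h $ 1 * (x $ 1 * g x) + h $ 2 * (x $ 2 * g x)
          + h $ 3 * (x $ 3 * g x) + h $ 4 * (x $ 4 * g x))"
    by (intro form_over_add form_over_scale form_over_mult_var g h R0) (auto intro: R)
  then show ?thesis by (simp add: lf_def sum_4 algebra_simps)
qed

text \<open>Such products are the equations tested in \<open>reduces_to\<close>: their degree is
  fixed and their coefficients stay integral.\<close>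

lemma form_over_prod_lf:
  assumes "finite A" and h: "\<And>j i. j \<in> A \<Longrightarrow> h j $ i \<in> R" and R01: "0 \<in> R" "1 \<in> R"
    and R: "\<And>x y. x \<in> R \<Longrightarrow> y \<in> R \<Longrightarrow> x + y \<in> R" "\<And>x y. x \<in> R \<Longrightarrow> y \<in> R \<Longrightarrow> x * y \<in> R"
  shows "form_over R (card A) (\<lambda>x. \<Prod>j\<in>A. lf (h j) x)"
  using assms(1,2)
proof (induction A rule: finite_induct)
  case empty
  then show ?case using form_over_one[OF R01] by simp
next
  case (insert j A)
  then have "form_over R (Suc (card A)) (\<lambda>x. lf (h j) x * (\<Prod>j\<in>A. lf (h j) x))"
    by (intro form_over_mult_lf R01 R) auto
  then show ?case using insert by simp
qed

section \<open>Nonvanishing of polynomials\<close>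

lemma poly_along_line:
  "\<exists>q :: complex poly. \<forall>s. peval c (x + s *s d) = poly q s"
proof
  show "\<forall>s. peval c (x + s *s d) =
     poly (\<Sum>e\<in>{e. c e \<noteq> 0}. smult (c e) (\<Prod>i\<in>UNIV. [:x $ i, d $ i:] ^ (e $ i))) s"
    by (simp add: peval_def poly_sum poly_prod poly_power)
qed

lemma finite_zeros_along_line:
  assumes "peval c (x + t *s d) \<noteq> 0"
  shows "finite {s. peval c (x + s *s d) = 0}"
proof -
  obtain q where q: "\<And>s. peval c (x + s *s d) = poly q s" using poly_along_line by blast
  then have "q \<noteq> 0" using assms by auto
  then show ?thesis by (simp add: q poly_roots_finite)
qed

text \<open>A nonzero polynomial in one variable has finitely many roots. Applied to one coordinate
  at a time, this yields Zariski density of points whose coordinates are restricted successively to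
  infinite sets.\<close>

lemma nonvanishing_along_line:
  assumes "peval c (x + t *s d) \<noteq> 0" "infinite A"
  shows "\<exists>s\<in>A. peval c (x + s *s d) \<noteq> 0"
proof (rule ccontr)
  assume "\<not> ?thesis"
  then have "A \<subseteq> {s. peval c (x + s *s d) = 0}" by auto
  then show False using finite_zeros_along_line[OF assms(1)] assms(2) finite_subset by metis
qed

lemma prod_4: "prod f (UNIV::4 set) = f 1 * f 2 * f 3 * f 4"
  unfolding UNIV_4 by (simp add: ac_simps)

text \<open>Kronecker substitution: distinct monomials of degree below N in each variable become
  distinct powers of one variable.\<close>

lemma nonzero_poly_nonvanishing:
  assumes "is_poly c" "c \<noteq> (\<lambda>_. 0)"
  shows "\<exists>x. peval c x \<noteq> 0"
proof -
  let ?F = "{e. c e \<noteq> 0}"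
  have F: "finite ?F" using assms by (simp add: is_poly_def)
  \<comment> \<open>All exponents are smaller than \<open>N\<close>, so the entries of
    \<open>e\<close> are the digits of \<open>k e\<close> in base \<open>N\<close>.\<close>
  define N where "N = Suc (\<Sum>e\<in>?F. \<Sum>i\<in>UNIV. e $ i)"
  have lt: "e $ i < N" if "e \<in> ?F" for e i
  proof -
    have "e $ i \<le> (\<Sum>i\<in>UNIV. e $ i)" by (intro member_le_sum) auto
    also have "\<dots> \<le> (\<Sum>e\<in>?F. \<Sum>i\<in>UNIV. e $ i)" by (rule member_le_sum[OF that _ F]) simp
    finally show ?thesis by (simp add: N_def)
  qed
  define k where "k e = e $ 1 + N * (e $ 2 + N * (e $ 3 + N * e $ 4))" for e :: "nat ^ 4"
  have base: "p = p' \<and> q = q'" if "p + N * q = p' + N * q'" "p < N" "p' < N" for p q p' q'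
  proof -
    have "(p + N * q) mod N = (p' + N * q') mod N" "(p + N * q) div N = (p' + N * q') div N"
      by (simp_all only: that(1))
    then show ?thesis using that(2,3) by simp
  qed
  have inj: "inj_on k ?F"
  proof (rule inj_onI)
    fix e e' assume e: "e \<in> ?F" "e' \<in> ?F" "k e = k e'"
    note 1 = base[OF e(3)[unfolded k_def] lt[OF e(1)] lt[OF e(2)]]
    note 2 = base[OF 1[THEN conjunct2] lt[OF e(1)] lt[OF e(2)]]
    note 3 = base[OF 2[THEN conjunct2] lt[OF e(1)] lt[OF e(2)]]
    show "e = e'" using 1 2 3 by (simp add: vec_eq_iff forall_4)
  qed
  define q where "q = (\<Sum>e\<in>?F. monom (c e) (k e))"
  obtain e where e: "e \<in> ?F" using assms(2) by auto
  have "coeff q (k e) = (\<Sum>e'\<in>?F. if e' = e then c e' else 0)"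
    unfolding q_def coeff_sum using inj e by (intro sum.cong) (auto dest: inj_onD)
  then have "q \<noteq> 0" using e F by auto
  then obtain t where t: "poly q t \<noteq> 0" using poly_all_0_iff_0 by blast
  let ?x = "\<chi> i::4. t ^ (if i = 1 then 1 else if i = 2 then N else if i = 3 then N * N else N * N * N)"
  have "(\<Prod>i\<in>UNIV. ?x $ i ^ (e $ i)) = t ^ k e" for e
  proof -
    have "(\<Prod>i\<in>UNIV. ?x $ i ^ (e $ i)) =
        t ^ e $ 1 * (t ^ N) ^ (e $ 2) * (t ^ (N * N)) ^ (e $ 3) * (t ^ (N * N * N)) ^ (e $ 4)"
      by (simp add: prod_4)
    also have "\<dots> = t ^ k e"
      unfolding power_mult[symmetric] power_add[symmetric] k_def by (simp add: algebra_simps)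
    finally show ?thesis .
  qed
  then have "peval c ?x = poly q t"
    by (simp add: peval_def q_def poly_sum poly_monom)
  then show ?thesis using t by (intro exI[of _ ?x]) simp
qed

lemma peval_scale:
  assumes "homog c"
  shows "\<exists>d. \<forall>s x. peval c (s *s x) = s ^ d * peval c x"
proof -
  obtain d where d: "\<And>e. c e \<noteq> 0 \<Longrightarrow> (\<Sum>i\<in>UNIV. e $ i) = d" using assms by (auto simp: homog_def)
  have "peval c (s *s x) = s ^ d * peval c x" for s x
    unfolding peval_def sum_distrib_left
    by (intro sum.cong) (auto simp: power_mult_distrib prod.distrib power_sum[symmetric] d)
  then show ?thesis by blast
qed

section \<open>Linear forms\<close>

lemma lf_add: "lf a (x + y) = lf a x + lf a y"
  and lf_scale: "lf a (s *s x) = s * lf a x"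
  and lf_add_left: "lf (a + b) x = lf a x + lf b x"
  and lf_diff_left: "lf (a - b) x = lf a x - lf b x"
  and lf_scale_left: "lf (s *s a) x = s * lf a x"
  by (simp_all add: lf_def sum.distrib sum_distrib_left sum_subtractf algebra_simps)

lemma lf_sum: "lf a (\<Sum>i\<in>A. f i) = (\<Sum>i\<in>A. lf a (f i))"
  by (induction A rule: infinite_finite_induct) (auto simp: lf_add, auto simp: lf_def)

lemmas lf_linear = lf_add lf_scale lf_add_left lf_diff_left lf_scale_left

context numfield
begin

lemma lf_in_K: "rational_vec K a \<Longrightarrow> rational_vec K x \<Longrightarrow> lf a x \<in> K"
  by (auto simp: lf_def rational_vec_def intro!: K_sum K_mult)

lemma det_in_K:
  fixes A :: "complex ^ 'n ^ 'n"
  assumes "\<And>i j. A $ i $ j \<in> K" shows "det A \<in> K"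
  unfolding det_def by (intro K_sum K_mult K_prod K_of_int assms)

text \<open>The vectors \<open>b i\<close> are the columns of the inverse of the matrix with rows
  \<open>a i\<close>. Independence is over the complex numbers; Cramer's rule shows that the inverse
  nevertheless has entries in \<open>K\<close>.\<close>

lemma exists_dual_basis:
  fixes a :: "nat \<Rightarrow> complex ^ 4"
  assumes a: "\<forall>i<4. rational_vec K (a i)"
    and indep: "\<forall>c :: nat \<Rightarrow> complex. (\<Sum>i<4. c i *s a i) = 0 \<longrightarrow> (\<forall>i<4. c i = 0)"
  obtains b where "\<And>i. i < 4 \<Longrightarrow> rational_vec K (b i)"
    "\<And>i j. i < 4 \<Longrightarrow> j < 4 \<Longrightarrow> lf (a i) (b j) = (if i = j then 1 else 0)"
    "\<And>x. x = (\<Sum>i<4. lf (a i) x *s b i)"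
proof -
  \<comment> \<open>\<open>f\<close> and \<open>g\<close> are mutually inverse translations between
    the index type \<open>4\<close> and the numbers below 4.\<close>
  define f :: "4 \<Rightarrow> nat" where "f i = (if i = 1 then 0 else if i = 2 then 1 else if i = 3 then 2 else 3)" for i
  define g :: "nat \<Rightarrow> 4" where "g i = (if i = 0 then 1 else if i = 1 then 2 else if i = 2 then 3 else 4)" for i
  have f: "f i < 4" "g (f i) = i" for i
    using exhaust_4[of i] by (auto simp: f_def g_def)
  have g: "f (g i) = i" if "i < 4" for i
    using that by (auto simp: f_def g_def)
  have sum_f: "(\<Sum>i\<in>UNIV. h i) = (\<Sum>i<4. h (g i))" for h :: "4 \<Rightarrow> complex ^ 4"
    by (rule sum.reindex_bij_witness[of _ g f]) (auto simp: f g)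
  define A where "A = (\<chi> i. a (f i))"
  have A_in_K: "A $ i $ j \<in> K" for i j using a f by (auto simp: A_def rational_vec_def)
  have "\<forall>c. (\<Sum>i\<in>UNIV. c i *s row i A) = 0 \<longrightarrow> (\<forall>i. c i = 0)"
  proof (intro allI impI)
    fix c and i :: 4 assume "(\<Sum>i\<in>UNIV. c i *s row i A) = 0"
    then have "(\<Sum>i<4. c (g i) *s a i) = 0"
      by (simp add: sum_f row_def A_def g vec_lambda_eta)
    then have "c (g (f i)) = 0" using indep[rule_format, of "\<lambda>i. c (g i)" "f i"] f by simp
    then show "c i = 0" by (simp add: f)
  qed
  then obtain B where AB: "A ** B = mat 1"
    unfolding matrix_right_invertible_independent_rows[symmetric] by blast
  then have BA: "B ** A = mat 1" by (simp add: matrix_left_right_inverse)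
  have detA: "det A \<noteq> 0" using AB invertible_det_nz invertible_right_inverse by blast
  have B_in_K: "B $ i $ j \<in> K" for i j
  proof -
    have "A *v column j B = column j (A ** B)"
      by (simp add: matrix_vector_mult_def matrix_matrix_mult_def column_def vec_eq_iff)
    then have "A *v column j B = axis j 1"
      unfolding AB by (simp add: column_def mat_def axis_def vec_eq_iff)
    then have "column j B = (\<chi> k. det (\<chi> i l. if l = k then axis j 1 $ i else A $ i $ l) / det A)"
      using cramer[OF detA] by blast
    then have "B $ i $ j = det (\<chi> i' l. if l = i then axis j 1 $ i' else A $ i' $ l) / det A"
      by (simp add: column_def vec_eq_iff)
    also have "\<dots> \<in> K"
      using A_in_K by (intro K_divide det_in_K) (auto simp: axis_def)
    finally show ?thesis .
  qed
  show ?thesis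
  proof (rule that[of "\<lambda>i. column (g i) B"])
    fix i j :: nat assume ij: "i < 4" "j < 4"
    have "lf (a i) (column (g j) B) = (A ** B) $ g i $ g j"
      using ij by (simp add: lf_def column_def matrix_matrix_mult_def A_def g)
    also have "\<dots> = (if g i = g j then 1 else 0)" by (simp only: AB mat_def vec_lambda_beta)
    also have "g i = g j \<longleftrightarrow> i = j" using g[OF ij(1)] g[OF ij(2)] by metis
    finally show "lf (a i) (column (g j) B) = (if i = j then 1 else 0)" .
  next
    fix x :: "complex ^ 4"
    have "x = B *v (A *v x)" by (simp add: matrix_vector_mul_assoc BA)
    also have "\<dots> = (\<Sum>i\<in>UNIV. (A *v x) $ i *s column i B)"
      by (rule matrix_mult_sum)
    also have "\<dots> = (\<Sum>i<4. lf (a i) x *s column (g i) B)"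
      unfolding sum_f by (intro sum.cong) (auto simp: matrix_vector_mult_def lf_def A_def g)
    finally show "x = (\<Sum>i<4. lf (a i) x *s column (g i) B)" .
  qed (auto simp: rational_vec_def column_def B_in_K)
qed

end

section \<open>Units and congruences modulo the maximal ideal\<close>

context place
begin

lemma unit_mult: "x \<in> R - M \<Longrightarrow> y \<in> R - M \<Longrightarrow> x * y \<in> R - M"
  using M_prime by (auto intro: R_mult)

lemma unit_divide: "x \<in> R - M \<Longrightarrow> y \<in> R - M \<Longrightarrow> x / y \<in> R - M"
  unfolding unit_iff by (auto simp: val_divide K_divide)

lemma unit_power: "x \<in> R - M \<Longrightarrow> x ^ n \<in> R - M"
  using M_power by (auto intro: R_power)

lemma unit_add_M:
  assumes "x \<in> R - M" "y \<in> M" shows "x + y \<in> R - M"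
proof -
  have "x + y \<notin> M" using assms M_diff[of "x + y" y] by auto
  then show ?thesis using assms by (auto intro: R_add M_in_O)
qed

lemma integral_if_unit_multiple: "x \<in> K \<Longrightarrow> y \<in> R - M \<Longrightarrow> x * y \<in> R \<Longrightarrow> x \<in> R"
  unfolding unit_iff by (cases "x = 0") (auto simp: val_ring_def val_mult)

lemma power_minus_one_M:
  assumes "x \<in> R" "x ^ m - 1 \<in> M" shows "x ^ (m * q) - 1 \<in> M"
proof (induction q)
  case (Suc q)
  have "x ^ (m * Suc q) - 1 = x ^ m * (x ^ (m * q) - 1) + (x ^ m - 1)"
    by (simp add: algebra_simps power_add)
  also have "\<dots> \<in> M" using Suc assms by (intro M_add M_mult R_power)
  finally show ?case .
qed simp

end

section \<open>Integral points off four planes and concurrent lines\<close>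

text \<open>This is the normalized situation: \<open>b\<close> is dual to \<open>a\<close>, so the
  values \<open>lf (a i) x\<close> are the coordinates of \<open>x\<close>, and only the plane of
  index 0 may contain \<open>p\<close>. The numbers in \<open>minor_nonzero\<close> are the Pluecker
  coordinates of the lines; they are nonzero because the lines avoid the intersections of two
  planes.\<close>

locale plane_line_configuration = numfield +
  fixes a b :: "nat \<Rightarrow> complex ^ 4" and p :: "complex ^ 4"
    and u w :: "nat \<Rightarrow> complex ^ 4" and r :: nat
  assumes rational_a: "i < 4 \<Longrightarrow> rational_vec K (a i)"
    and rational_b: "i < 4 \<Longrightarrow> rational_vec K (b i)"
    and lf_a_b: "i < 4 \<Longrightarrow> j < 4 \<Longrightarrow> lf (a i) (b j) = (if i = j then 1 else 0)"
    and expand: "x = (\<Sum>i<4. lf (a i) x *s b i)"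
    and rational_p: "rational_vec K p"
    and p_off_planes: "i \<in> {1, 2, 3} \<Longrightarrow> lf (a i) p \<noteq> 0"
    and rational_u: "j < r \<Longrightarrow> rational_vec K (u j)"
    and rational_w: "j < r \<Longrightarrow> rational_vec K (w j)"
    and p_on_lines: "j < r \<Longrightarrow> p \<in> line_cone (u j) (w j)"
    and minor_nonzero: "j < r \<Longrightarrow> k < l \<Longrightarrow> l < 4 \<Longrightarrow>
      lf (a k) (u j) * lf (a l) (w j) - lf (a l) (u j) * lf (a k) (w j) \<noteq> 0"
begin

definition "P i = lf (a i) p"
definition "minor j k l = lf (a k) (u j) * lf (a l) (w j) - lf (a l) (u j) * lf (a k) (w j)"
definition "D = (\<Union>i<4. plane_cone (a i)) \<union> (\<Union>j<r. line_cone (u j) (w j))"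

text \<open>\<open>E j\<close> is the expansion of the determinant of the coordinates 0, 1, 2 of
  \<open>x\<close>, \<open>u j\<close>, \<open>w j\<close>; it cuts out the plane spanned by the
  line and \<open>b 3\<close>. Likewise \<open>G j\<close> belongs to the line and
  \<open>b 2\<close>.\<close>

definition "E j = minor j 1 2 *s a 0 - minor j 0 2 *s a 1 + minor j 0 1 *s a 2"
definition "G j = minor j 1 3 *s a 0 - minor j 0 3 *s a 1 + minor j 0 1 *s a 3"

definition "V y = (\<Sum>i<4. y i *s b i)"

text \<open>Where all these numbers have value 0, the change of coordinates is integral in both
  directions and the configuration stays nondegenerate modulo the place. A zero among them excludes
  no place, as its value is 0 by convention. The number 2 is listed because its powers serve as
  coordinates.\<close>

definition "bad_numbers = {2} \<union> (\<lambda>(i, k). a i $ k) ` ({..<4} \<times> UNIV) \<union> (\<lambda>(i, k). b i $ k) ` ({..<4} \<times> UNIV)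
   \<union> P ` {..<4} \<union> (\<lambda>(j, k, l). minor j k l) ` ({..<r} \<times> {..<4} \<times> {..<4})"

definition "bad_places = {v. finite_place K v \<and> (\<exists>x\<in>bad_numbers. v x \<noteq> 0)}"

lemma finite_bad_places: "finite bad_places"
proof -
  have "bad_places = (\<Union>x\<in>bad_numbers. {v. finite_place K v \<and> v x \<noteq> 0})"
    by (auto simp: bad_places_def)
  then show ?thesis by (simp only:) (intro finite_UN_I finite_nonunit_places, simp add: bad_numbers_def)
qed

lemma bad_numbers_memb:
  "2 \<in> bad_numbers"
  "i < 4 \<Longrightarrow> a i $ t \<in> bad_numbers"
  "i < 4 \<Longrightarrow> b i $ t \<in> bad_numbers"
  "i < 4 \<Longrightarrow> P i \<in> bad_numbers"
  "j < r \<Longrightarrow> k < 4 \<Longrightarrow> l < 4 \<Longrightarrow> minor j k l \<in> bad_numbers"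
  unfolding bad_numbers_def
  by (blast, rule UnI1, rule UnI1, rule UnI1, rule UnI2, rule image_eqI[of _ _ "(i, t)"], simp, simp,
      rule UnI1, rule UnI1, rule UnI2, rule image_eqI[of _ _ "(i, t)"], simp, simp,
      blast, rule UnI2, rule image_eqI[of _ _ "(j, k, l)"], simp, simp)

lemma bad_numbers_in_K: "bad_numbers \<subseteq> K"
  using rational_a rational_b rational_p rational_u rational_w
  by (auto simp: bad_numbers_def rational_vec_def P_def minor_def intro!: lf_in_K K_diff K_mult)

lemma P_in_K: "i < 4 \<Longrightarrow> P i \<in> K"
  using bad_numbers_in_K bad_numbers_memb by blast

lemma minor_in_K: "j < r \<Longrightarrow> k < 4 \<Longrightarrow> l < 4 \<Longrightarrow> minor j k l \<in> K"
  using bad_numbers_in_K bad_numbers_memb by blast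

lemma minor_nz: "j < r \<Longrightarrow> k < l \<Longrightarrow> l < 4 \<Longrightarrow> minor j k l \<noteq> 0"
  using minor_nonzero by (simp add: minor_def)

lemma lf_V: "i < 4 \<Longrightarrow> lf (a i) (V y) = y i"
proof -
  assume i: "i < 4"
  have "lf (a i) (V y) = (\<Sum>j<4. if j = i then y j else 0)"
    unfolding V_def lf_sum using i by (intro sum.cong) (auto simp: lf_scale lf_a_b)
  then show ?thesis using i by simp
qed

lemma V_coords: "V (\<lambda>i. lf (a i) x) = x"
  unfolding V_def by (rule expand[symmetric])

lemma E_expand: "lf (E j) x = minor j 1 2 * lf (a 0) x - minor j 0 2 * lf (a 1) x + minor j 0 1 * lf (a 2) x"
  and G_expand: "lf (G j) x = minor j 1 3 * lf (a 0) x - minor j 0 3 * lf (a 1) x + minor j 0 1 * lf (a 3) x"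
  by (simp_all add: E_def G_def lf_linear)

lemma E_vanishes: "x \<in> line_cone (u j) (w j) \<Longrightarrow> lf (E j) x = 0"
  and G_vanishes: "x \<in> line_cone (u j) (w j) \<Longrightarrow> lf (G j) x = 0"
  by (auto simp: line_cone_def E_expand G_expand lf_linear minor_def algebra_simps)

text \<open>Since p lies on the line, one may eliminate one coordinate between E, G and the relations
  E p = 0, G p = 0.\<close>

lemma
  assumes "j < r"
  shows E_identity: "P 0 * lf (E j) x = minor j 0 1 * (P 0 * lf (a 2) x - P 2 * lf (a 0) x)
      + minor j 0 2 * (P 1 * lf (a 0) x - P 0 * lf (a 1) x)"
    and G_identity: "P 1 * lf (G j) x = minor j 1 3 * (P 1 * lf (a 0) x - P 0 * lf (a 1) x)
      + minor j 0 1 * (P 1 * lf (a 3) x - P 3 * lf (a 1) x)"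
proof -
  have "minor j 1 2 * P 0 - minor j 0 2 * P 1 + minor j 0 1 * P 2 = 0"
    using E_vanishes[OF p_on_lines[OF assms]] by (simp add: E_expand P_def)
  then show "P 0 * lf (E j) x = minor j 0 1 * (P 0 * lf (a 2) x - P 2 * lf (a 0) x)
      + minor j 0 2 * (P 1 * lf (a 0) x - P 0 * lf (a 1) x)"
    unfolding E_expand by algebra
  have "minor j 1 3 * P 0 - minor j 0 3 * P 1 + minor j 0 1 * P 3 = 0"
    using G_vanishes[OF p_on_lines[OF assms]] by (simp add: G_expand P_def)
  then show "P 1 * lf (G j) x = minor j 1 3 * (P 1 * lf (a 0) x - P 0 * lf (a 1) x)
      + minor j 0 1 * (P 1 * lf (a 3) x - P 3 * lf (a 1) x)"
    unfolding G_expand by algebra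
qed

end

section \<open>Criterion for not reducing to the configuration at a good place\<close>

locale good_place = plane_line_configuration + place +
  assumes good: "v \<notin> bad_places"
begin

lemma good_number_integral:
  assumes "x \<in> bad_numbers" shows "x \<in> R" and "x \<noteq> 0 \<Longrightarrow> x \<in> R - M"
proof -
  have "x \<in> K" "v x = 0" using assms bad_numbers_in_K good finite_place by (auto simp: bad_places_def)
  then show "x \<in> R" "x \<noteq> 0 \<Longrightarrow> x \<in> R - M" by (auto simp: val_ring_def max_ideal_def)
qed

lemma two_unit: "2 \<in> R - M"
  by (rule good_number_integral(2)[OF bad_numbers_memb(1)]) simp

lemma a_integral: "i < 4 \<Longrightarrow> a i $ t \<in> R"
  and b_integral: "i < 4 \<Longrightarrow> b i $ t \<in> R"
  and P_integral: "i < 4 \<Longrightarrow> P i \<in> R"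
  and minor_integral: "j < r \<Longrightarrow> k < 4 \<Longrightarrow> l < 4 \<Longrightarrow> minor j k l \<in> R"
  by (auto intro!: good_number_integral(1) bad_numbers_memb)

lemma P_unit: "i < 4 \<Longrightarrow> P i \<noteq> 0 \<Longrightarrow> P i \<in> R - M"
  by (intro good_number_integral(2) bad_numbers_memb)

lemma minor_unit: "j < r \<Longrightarrow> k < l \<Longrightarrow> l < 4 \<Longrightarrow> minor j k l \<in> R - M"
  by (intro good_number_integral(2) bad_numbers_memb minor_nz) auto

lemma E_integral: "j < r \<Longrightarrow> E j $ k \<in> R" and G_integral: "j < r \<Longrightarrow> G j $ k \<in> R"
  by (auto simp: E_def G_def intro!: R_add R_diff R_mult minor_integral a_integral)

lemma lf_integral: "(\<And>k. h $ k \<in> R) \<Longrightarrow> (\<And>k. x $ k \<in> R) \<Longrightarrow> lf h x \<in> R"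
  unfolding lf_def by (intro R_sum R_mult)

lemma V_integral: "(\<And>i. i < 4 \<Longrightarrow> y i \<in> R) \<Longrightarrow> V y $ k \<in> R"
  unfolding V_def by (auto intro!: R_sum R_mult b_integral)

text \<open>Multiply the four plane forms and, for each line, whichever of \<open>E j\<close> and
  \<open>G j\<close> is a unit at \<open>x\<close>. The product vanishes on \<open>D\<close> and has
  integral coefficients, but takes a unit value at \<open>x\<close>.\<close>

lemma not_reduces_to_D:
  assumes units: "\<And>i. i < 4 \<Longrightarrow> lf (a i) x \<in> R - M"
    and lines: "\<And>j. j < r \<Longrightarrow> lf (E j) x \<notin> M \<or> lf (G j) x \<notin> M"
  shows "\<not> reduces_to K v D x"
proof
  assume "reduces_to K v D x"
  then obtain l i where "l \<in> K - {0}" "\<forall>i. l * x $ i \<in> R" "l * x $ i \<noteq> 0" "v (l * x $ i) = 0"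
    and red: "\<forall>c\<in>vanishing_ideal K D. homog c \<and> coeffs_in c R \<longrightarrow> peval c (l *s x) \<in> M"
    unfolding reduces_to_def by (elim bexE conjE exE)
  then have l: "l \<in> K" "l \<noteq> 0" "\<And>i. l * x $ i \<in> R" "l * x $ i \<noteq> 0" "v (l * x $ i) = 0" by auto
  \<comment> \<open>The scaling factor \<open>l\<close> turns out to be a unit: the unit
    \<open>lf (a 0) x\<close> forces it into \<open>R\<close>, and since \<open>x\<close> is
    integral, the unit coordinate of the scaled vector keeps it out of \<open>M\<close>.\<close>
  have x_int: "x $ k \<in> R" for k
    using V_integral[of "\<lambda>i. lf (a i) x" k] units by (simp add: V_coords)
  have "l * lf (a 0) x \<in> R"
    unfolding lf_scale[symmetric] using l a_integral by (intro lf_integral) auto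
  then have "l \<in> R" using integral_if_unit_multiple[OF l(1) units[of 0]] by simp
  moreover have "l \<notin> M" using M_mult(2)[of l "x $ i"] x_int l(4,5) by (auto simp: max_ideal_def)
  ultimately have l_unit: "l \<in> R - M" by simp
  \<comment> \<open>Indices below 4 stand for the planes, and \<open>4 + j\<close> for line
    \<open>j\<close>.\<close>
  define h where "h t = (if t < 4 then a t else if lf (E (t - 4)) x \<notin> M then E (t - 4) else G (t - 4))" for t
  have h_int: "h t $ k \<in> R" if "t < 4 + r" for t k
    using that E_integral G_integral a_integral by (auto simp: h_def)
  have h_unit: "lf (h t) x \<in> R - M" if "t < 4 + r" for t
    using lf_integral[OF h_int[OF that] x_int] lines[of "t - 4"] units[of t] that by (auto simp: h_def)
  have h_vanish: "(\<Prod>t<4 + r. lf (h t) z) = 0" if "z \<in> D" for z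
  proof -
    consider i where "i < 4" "lf (a i) z = 0" | j where "j < r" "z \<in> line_cone (u j) (w j)"
      using \<open>z \<in> D\<close> by (auto simp: D_def plane_cone_def)
    then have "\<exists>t<4 + r. lf (h t) z = 0"
    proof cases
      case 1 then show ?thesis by (intro exI[of _ i]) (simp add: h_def)
    next
      case 2 then show ?thesis using E_vanishes G_vanishes by (intro exI[of _ "4 + j"]) (simp add: h_def)
    qed
    then show ?thesis by auto
  qed
  have "form_over R (card {..<4 + r}) (\<lambda>x. \<Prod>t<4 + r. lf (h t) x)"
    using h_int by (intro form_over_prod_lf) (auto intro: R_add R_mult)
  then obtain c where c: "is_poly c" "coeffs_in c R" "\<And>e. c e \<noteq> 0 \<Longrightarrow> (\<Sum>i\<in>UNIV. e $ i) = card {..<4 + r}"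
    "\<And>x. peval c x = (\<Prod>t<4 + r. lf (h t) x)"
    unfolding form_over_def by blast
  have "c \<in> vanishing_ideal K D"
    using c h_vanish R_in_K by (auto simp: vanishing_ideal_def coeffs_in_def)
  moreover have "homog c" using c(3) by (auto simp: homog_def)
  ultimately have "(\<Prod>t<4 + r. lf (h t) (l *s x)) \<in> M" using red c by metis
  moreover have "(\<Prod>t<4 + r. lf (h t) (l *s x)) \<in> R - M"
    unfolding lf_scale using l_unit h_unit by (intro M_prod unit_mult) auto
  ultimately show False by blast
qed

end

section \<open>Points with special coordinates\<close>

context plane_line_configuration
begin

lemma V_upd:
  assumes "i < 4" shows "V (y(i := s)) = V (y(i := 0)) + s *s b i"
proof -
  have "V (y(i := s)) = (\<Sum>j<4. (y(i := 0)) j *s b j + (if j = i then s *s b j else 0))"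
    unfolding V_def by (intro sum.cong) auto
  also have "\<dots> = V (y(i := 0)) + s *s b i"
    using assms by (simp add: sum.distrib V_def)
  finally show ?thesis .
qed

lemma nonvanishing_upd:
  assumes "peval c (V y) \<noteq> 0" "i < 4" "infinite A"
  shows "\<exists>s\<in>A. peval c (V (y(i := s))) \<noteq> 0"
proof -
  have "peval c (V (y(i := 0)) + y i *s b i) \<noteq> 0"
    using assms(1) V_upd[OF assms(2), of y "y i"] by simp
  from nonvanishing_along_line[OF this assms(3)] show ?thesis
    by (simp add: V_upd[OF assms(2), symmetric])
qed

text \<open>If \<open>P 0\<close> is nonzero, then \<open>P 0 * \<alpha> i = P i\<close>, so
  \<open>P 1 - P 0 * y 1\<close> and \<open>P 0 * y 2 - P 2\<close> become multiples of powers of 2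
  minus 1. If \<open>P 0 = 0\<close>, the first of these is the unit \<open>P 1\<close> for every
  \<open>y\<close>, and the constant 1 serves.\<close>

definition "\<alpha> i = (if P 0 = 0 then 1 else P i / P 0)"

lemma P_nz: "i \<in> {1, 2, 3} \<Longrightarrow> P i \<noteq> 0"
  using p_off_planes by (simp add: P_def)

lemma \<alpha>_nz: "i \<in> {1, 2} \<Longrightarrow> \<alpha> i \<noteq> 0"
  using P_nz by (auto simp: \<alpha>_def)

lemma \<alpha>_in_K: "i < 4 \<Longrightarrow> \<alpha> i \<in> K"
  using P_in_K by (auto simp: \<alpha>_def K_divide)

text \<open>The exponent \<open>k * n + 1\<close> makes \<open>2 ^ (k * n + 1) - 1\<close> congruent
  to 1 modulo \<open>2 ^ k - 1\<close>. The last coordinate is chosen so that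
  \<open>P 1 * y 3 - P 3 * y 1\<close> is a multiple of \<open>2 ^ m - 1\<close>.\<close>

definition special_coords :: "nat \<Rightarrow> nat \<Rightarrow> nat \<Rightarrow> (nat \<Rightarrow> complex) \<Rightarrow> bool" where
  "special_coords k n m y \<longleftrightarrow> y 0 = 1 \<and> y 1 = \<alpha> 1 * 2 ^ k \<and> y 2 = \<alpha> 2 * 2 ^ (k * n + 1) \<and>
     y 3 = P 3 / P 1 * y 1 * 2 ^ m"

end

context good_place
begin

lemma \<alpha>_unit: "i \<in> {1, 2} \<Longrightarrow> \<alpha> i \<in> R - M"
  using P_unit[of i] P_unit[of 0] P_nz[of i] unit_divide[of "P i" "P 0"] by (auto simp: \<alpha>_def)

lemma special_coords_units:
  assumes "special_coords k n m y" "i < 4" shows "y i \<in> R - M"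
proof -
  have 1: "y 1 \<in> R - M"
    using assms \<alpha>_unit two_unit by (auto simp only: special_coords_def intro!: unit_mult unit_power)
  have "y 0 \<in> R - M" using assms by (simp add: special_coords_def)
  moreover have "y 2 \<in> R - M"
    using assms \<alpha>_unit[of 2] two_unit unit_mult[OF _ unit_power] by (auto simp only: special_coords_def)
  moreover have "P 3 / P 1 * y 1 * 2 ^ m \<in> R - M"
    by (intro unit_mult unit_divide unit_power P_unit 1 two_unit P_nz) auto
  then have "y 3 \<in> R - M" using assms by (simp only: special_coords_def)
  moreover have "i = 0 \<or> i = 1 \<or> i = 2 \<or> i = 3" using assms(2) by auto
  ultimately show ?thesis using 1 by auto
qed

text \<open>Suppose both forms lie in \<open>M\<close>. By the identity for \<open>E j\<close> the
  number \<open>q\<close> is then a unit, as otherwise \<open>E j\<close> would be one. Modulo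
  \<open>M\<close>, the identity for \<open>G j\<close> then equates \<open>P 1\<close> times its
  value with a unit multiple of \<open>q\<close>, which is impossible.\<close>

lemma special_coords_avoid_line:
  assumes y: "special_coords k n m y" and j: "j < r"
    and m: "lf (E j) (V y) \<in> M \<Longrightarrow> 2 ^ m - 1 \<in> M"
  shows "lf (E j) (V y) \<notin> M \<or> lf (G j) (V y) \<notin> M"
proof (rule ccontr)
  assume "\<not> ?thesis"
  then have E: "lf (E j) (V y) \<in> M" and G: "lf (G j) (V y) \<in> M" by auto
  define q where "q = P 1 - P 0 * y 1"
  have y01: "y 0 = 1" "y 1 \<in> R" "y 2 \<in> R"
    using y special_coords_units[OF y, of 1] special_coords_units[OF y, of 2]
    by (simp add: special_coords_def, simp, simp)
  have Eid: "P 0 * lf (E j) (V y) = minor j 0 1 * (P 0 * y 2 - P 2) + minor j 0 2 * q"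
    using E_identity[OF j, of "V y"] by (simp add: lf_V y01 q_def)
  have Gid: "P 1 * lf (G j) (V y) = minor j 1 3 * q + minor j 0 1 * (P 1 * y 3 - P 3 * y 1)"
    using G_identity[OF j, of "V y"] by (simp add: lf_V y01 q_def)
  have q: "q \<in> R - M"
  proof (cases "P 0 = 0")
    case True
    then show ?thesis using P_unit[of 1] P_nz[of 1] by (simp add: q_def)
  next
    case P0: False
    have "q \<notin> M"
    proof
      assume qM: "q \<in> M"
      have "q = - (P 1 * (2 ^ k - 1))"
        using y P0 by (simp add: q_def special_coords_def \<alpha>_def algebra_simps)
      then have "P 1 * (2 ^ k - 1) \<in> M" using M_minus[OF qM] by simp
      then have "2 ^ k - 1 \<in> M"
        using M_prime[of "P 1" "2 ^ k - 1"] P_unit[of 1] P_nz[of 1] by (simp add: R_diff R_power)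
      then have "2 ^ (k * n) - 1 \<in> M" by (intro power_minus_one_M) auto
      \<comment> \<open>The left side is \<open>2 ^ (k * n + 1) - 1\<close>, written so that its
        residue 1 is visible.\<close>
      then have "1 + 2 * (2 ^ (k * n) - 1) \<in> R - M" by (intro unit_add_M M_mult) auto
      then have "P 2 * (1 + 2 * (2 ^ (k * n) - 1)) \<in> R - M"
        using P_nz by (intro unit_mult P_unit) auto
      also have "P 2 * (1 + 2 * (2 ^ (k * n) - 1)) = P 0 * y 2 - P 2"
        using y P0 by (simp add: special_coords_def \<alpha>_def algebra_simps)
      finally have "P 0 * lf (E j) (V y) \<in> R - M"
        unfolding Eid using j qM by (intro unit_add_M unit_mult M_mult minor_unit minor_integral) auto
      then show False using M_mult(1)[OF P_integral E, of 0] by simp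
    qed
    moreover have "q \<in> R" unfolding q_def using y01 by (intro R_diff R_mult P_integral) auto
    ultimately show ?thesis by simp
  qed
  \<comment> \<open>The second term of the identity for \<open>G j\<close> vanishes modulo
    \<open>M\<close>, leaving the unit \<open>minor j 1 3 * q\<close>.\<close>
  have "P 1 * y 3 - P 3 * y 1 = P 3 * y 1 * (2 ^ m - 1)"
    using y P_nz[of 1] by (simp add: special_coords_def algebra_simps)
  also have "\<dots> \<in> M" using m[OF E] y01 by (intro M_mult(1) R_mult P_integral) auto
  finally have "P 1 * lf (G j) (V y) \<in> R - M"
    unfolding Gid using j q by (intro unit_add_M unit_mult M_mult minor_unit minor_integral) auto
  then show False using M_mult(1)[OF P_integral G, of 1] by simp
qed

end

lemma infinite_powers_of_two:
  fixes z :: complex and f :: "nat \<Rightarrow> nat"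
  assumes "z \<noteq> 0" "inj f" shows "infinite (range (\<lambda>k. z * 2 ^ f k))"
proof -
  have "inj (\<lambda>k. z * 2 ^ f k)"
  proof (rule injI)
    fix k l assume "z * 2 ^ f k = z * 2 ^ f l"
    then have "norm ((2::complex) ^ f k) = norm ((2::complex) ^ f l)" using assms by simp
    then have "(2::real) ^ f k = 2 ^ f l" by (simp add: norm_power)
    then show "k = l" using assms(2) by (simp add: inj_eq)
  qed
  then show ?thesis by (rule range_inj_infinite)
qed

section \<open>Zariski density and potential density\<close>

context plane_line_configuration
begin

text \<open>Start at a point where \<open>c\<close> does not vanish and move its coordinates 0, 1,
  2, 3 in this order to special values, keeping \<open>c\<close> nonzero. Each set of admissible
  values is infinite, but depends on the earlier choices.\<close>

lemma zariski_dense_integral_points: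
  assumes S: "bad_places \<subseteq> S"
  shows "zariski_dense K (integral_points K S D)"
  unfolding zariski_dense_def
proof (intro allI impI)
  fix c assume "is_poly c \<and> coeffs_in c K \<and> homog c \<and> c \<noteq> (\<lambda>_. 0)"
  then have c: "is_poly c" "homog c" "c \<noteq> (\<lambda>_. 0)" by auto
  obtain x0 where "peval c x0 \<noteq> 0" using nonzero_poly_nonvanishing c by blast
  then have "peval c (V (\<lambda>i. lf (a i) x0)) \<noteq> 0" by (simp add: V_coords)
  \<comment> \<open>Coordinate 0 is first made nonzero; since \<open>c\<close> is homogeneous, it
    can then be scaled to 1.\<close>
  moreover have "infinite (- {0 :: complex})" by (simp add: Compl_eq_Diff_UNIV infinite_UNIV_char_0)
  ultimately obtain s where s: "s \<in> - {0}" "peval c (V ((\<lambda>i. lf (a i) x0)(0 := s))) \<noteq> 0"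
    using nonvanishing_upd[of c "\<lambda>i. lf (a i) x0" 0 "- {0}"] by auto
  define y0 where "y0 = (\<lambda>i. inverse s * ((\<lambda>i. lf (a i) x0)(0 := s)) i)"
  have "V y0 = inverse s *s V ((\<lambda>i. lf (a i) x0)(0 := s))"
    unfolding V_def y0_def by (simp only: vec.scale_sum_right vector_smult_assoc)
  then have c0: "peval c (V y0) \<noteq> 0" using s peval_scale[OF c(2)] by auto
  have y00: "y0 0 = 1" using s by (simp add: y0_def)

  \<comment> \<open>The successor keeps the exponent positive, so that \<open>Suc k * n + 1\<close>
    takes infinitely many values below.\<close>
  have "infinite (range (\<lambda>k. \<alpha> 1 * 2 ^ Suc k))"
    by (rule infinite_powers_of_two) (auto simp: \<alpha>_nz inj_def)
  from nonvanishing_upd[OF c0 _ this, of 1]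
  obtain k where c1: "peval c (V (y0(1 := \<alpha> 1 * 2 ^ Suc k))) \<noteq> 0" by auto
  define y1 where "y1 = \<alpha> 1 * 2 ^ Suc k"

  \<comment> \<open>This is the value of \<open>E j\<close> at coordinates 1, \<open>y1\<close>,
    \<open>t\<close>. The finitely many \<open>t\<close> where it vanishes are discarded, because
    only nonzero numbers can be passed to \<open>power_of_two_cong_one\<close>.\<close>
  define e where "e j t = minor j 1 2 - minor j 0 2 * y1 + minor j 0 1 * t" for j t
  have "finite {t. e j t = 0}" if "j < r" for j
  proof (rule finite_subset)
    show "{t. e j t = 0} \<subseteq> {(minor j 0 2 * y1 - minor j 1 2) / minor j 0 1}"
      using minor_nz[OF that, of 0 1] by (auto simp: e_def field_simps)
  qed simp
  then have "finite (\<Union>j<r. {t. e j t = 0})" by simp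
  moreover have "infinite (range (\<lambda>n. \<alpha> 2 * 2 ^ (Suc k * n + 1)))"
    by (rule infinite_powers_of_two) (auto simp: \<alpha>_nz inj_def simp del: mult_Suc)
  ultimately have "infinite (range (\<lambda>n. \<alpha> 2 * 2 ^ (Suc k * n + 1)) - (\<Union>j<r. {t. e j t = 0}))"
    by (rule Diff_infinite_finite)
  from nonvanishing_upd[OF c1[folded y1_def] _ this, of 2]
  obtain t where t: "t \<in> range (\<lambda>n. \<alpha> 2 * 2 ^ (Suc k * n + 1)) - (\<Union>j<r. {t. e j t = 0})"
    "peval c (V (y0(1 := y1, 2 := t))) \<noteq> 0"
    by auto
  then obtain n where n: "t = \<alpha> 2 * 2 ^ (Suc k * n + 1)" "\<And>j. j < r \<Longrightarrow> e j t \<noteq> 0" by blast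

  have y1_K: "y1 \<in> K" and t_K: "t \<in> K"
    unfolding y1_def n(1) by (auto intro!: K_mult K_power \<alpha>_in_K)
  \<comment> \<open>\<open>E j\<close> does not involve coordinate 3, so its values are already
    fixed when \<open>m\<close> is chosen.\<close>
  obtain m where m: "m > 0" "\<And>v x. finite_place K v \<Longrightarrow> v 2 = 0 \<Longrightarrow> x \<in> (\<lambda>j. e j t) ` {..<r} \<Longrightarrow>
      x \<in> max_ideal K v \<Longrightarrow> 2 ^ m - 1 \<in> max_ideal K v"
  proof (rule power_of_two_cong_one[of "(\<lambda>j. e j t) ` {..<r}"])
    show "(\<lambda>j. e j t) ` {..<r} \<subseteq> K"
      unfolding e_def using y1_K t_K by (auto intro!: K_add K_diff K_mult minor_in_K)
    show "0 \<notin> (\<lambda>j. e j t) ` {..<r}" using n(2) by force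
  qed auto
  \<comment> \<open>Multiples of \<open>m\<close> preserve the congruence and leave infinitely many
    values for coordinate 3.\<close>
  have "infinite (range (\<lambda>q. P 3 / P 1 * y1 * 2 ^ (m * q)))"
    using m(1) by (intro infinite_powers_of_two) (auto simp: P_nz \<alpha>_nz y1_def inj_def)
  from nonvanishing_upd[OF t(2) _ this, of 3]
  obtain q where c3: "peval c (V (y0(1 := y1, 2 := t, 3 := P 3 / P 1 * y1 * 2 ^ (m * q)))) \<noteq> 0"
    by auto
  define y where "y = y0(1 := y1, 2 := t, 3 := P 3 / P 1 * y1 * 2 ^ (m * q))"
  have special: "special_coords (Suc k) n (m * q) y"
    by (simp add: special_coords_def y_def y00 y1_def n(1))
  have E_y: "lf (E j) (V y) = e j t" for j
    by (simp add: E_expand lf_V e_def y_def y00)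
  have "V y \<in> integral_points K S D"
    unfolding integral_points_def
  proof (intro CollectI conjI allI impI)
    have "y i \<in> K" if "i < 4" for i
    proof -
      have "i = 0 \<or> i = 1 \<or> i = 2 \<or> i = 3" using that by auto
      then show ?thesis
        using y1_K t_K by (auto simp: y_def y00 intro!: K_mult K_divide K_power P_in_K)
    qed
    then have "V y $ i \<in> K" for i
      using rational_b unfolding V_def by (auto simp: rational_vec_def intro!: K_sum K_mult)
    moreover have "V y \<noteq> 0"
    proof
      assume "V y = 0"
      then have "lf (a 0) 0 = y 0" using lf_V[of 0 y] by simp
      then show False by (simp add: lf_def y_def y00)
    qed
    ultimately show "proj_point K (V y)" by (simp add: proj_point_def)
  next
    fix v assume v: "finite_place K v \<and> v \<notin> S"
    interpret good_place K a b p u w r v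
      by unfold_locales (use v S in auto)
    show "\<not> reduces_to K v D (V y)"
    proof (rule not_reduces_to_D)
      show "lf (a i) (V y) \<in> R - M" if "i < 4" for i
        using special_coords_units[OF special that] by (simp add: lf_V that)
      fix j assume j: "j < r"
      show "lf (E j) (V y) \<notin> M \<or> lf (G j) (V y) \<notin> M"
      proof (rule special_coords_avoid_line[OF special j])
        assume "lf (E j) (V y) \<in> M"
        then have "2 ^ m - 1 \<in> M"
          using m(2)[of v "e j t"] v j two_unit unfolding E_y unit_iff by auto
        then show "2 ^ (m * q) - 1 \<in> M" by (intro power_minus_one_M) auto
      qed
    qed
  qed
  then show "\<exists>x\<in>integral_points K S D. peval c x \<noteq> 0" using c3 by (auto simp: y_def)
qed

text \<open>The witnesses are \<open>K\<close> itself and \<open>S\<close> enlarged by the bad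
  places. A place of \<open>K\<close> lying over another place of \<open>K\<close> equals it, as
  both are normalized.\<close>

lemma potentially_dense_D:
  assumes "finite S" "\<forall>v\<in>S. finite_place K v"
  shows "potentially_dense K S D"
  unfolding potentially_dense_def
proof (intro exI[of _ K] exI[of _ "S \<union> bad_places"] conjI ballI allI impI)
  fix v v' assume v: "v \<in> S" and v': "finite_place K v' \<and> lies_over K v' K v"
  interpret v: place K v using assms v by (intro place_of_finite_place) auto
  interpret v': place K v' using v' by (intro place_of_finite_place) auto
  obtain e where e: "e > 0" "\<And>x. x \<in> K - {0} \<Longrightarrow> v' x = e * v x"
    using v' by (auto simp: lies_over_def)
  obtain x where "x \<in> K" "x \<noteq> 0" "v' x = 1" using v'.ex_uniformizer by blast
  \<comment> \<open>An element of value 1 at \<open>v'\<close> forces the ramification index to be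
    1.\<close>
  then have "e * v x = 1" using e(2)[of x] by simp
  then have "e = 1" using e(1) by (simp add: zmult_eq_1_iff)
  then have "v' x = v x" for x
    using e(2)[of x] v.finite_place v'.finite_place
    by (cases "x \<in> K - {0}") (auto simp: finite_place_def)
  then show "v' \<in> S \<union> bad_places" using v by (metis UnI1 ext)
qed (use assms number_field finite_bad_places in \<open>auto simp: zariski_dense_integral_points bad_places_def\<close>)

end

section \<open>From the geometric hypotheses to the normalized configuration\<close>

lemma minor_nonzero_if_disjoint:
  assumes indep: "\<forall>s t. s *s u + t *s w = 0 \<longrightarrow> s = 0 \<and> t = 0"
    and disj: "line_cone u w \<inter> plane_cone a \<inter> plane_cone b \<subseteq> {0}"
  shows "lf a u * lf b w - lf b u * lf a w \<noteq> 0"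
proof
  assume 0: "lf a u * lf b w - lf b u * lf a w = 0"
  \<comment> \<open>On the line, the two plane forms have no common zero apart from the
    origin.\<close>
  have *: "s = 0 \<and> t = 0" if "s * lf a u + t * lf a w = 0" "s * lf b u + t * lf b w = 0" for s t
  proof -
    have "s *s u + t *s w \<in> line_cone u w \<inter> plane_cone a \<inter> plane_cone b"
      using that by (auto simp: line_cone_def plane_cone_def lf_linear)
    then show ?thesis using disj indep by blast
  qed
  \<comment> \<open>This pair of coefficients always annihilates the first form, and a vanishing
    minor makes it annihilate the second. Exchanging the roles shows that both forms vanish on the
    whole line, so \<open>u\<close> is a common zero.\<close>
  have "lf a w = 0 \<and> lf a u = 0"
    using *[of "lf a w" "- lf a u"] 0 by (simp add: algebra_simps)
  moreover have "lf b w = 0 \<and> lf b u = 0"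
    using *[of "lf b w" "- lf b u"] 0 by (simp add: algebra_simps)
  ultimately show False using *[of 1 0] by simp
qed

theorem theorem1p2:
  fixes K :: "complex set" and S :: "(complex \<Rightarrow> int) set"
    and a :: "nat \<Rightarrow> complex ^ 4" and r :: nat and u w :: "nat \<Rightarrow> complex ^ 4"
    and p :: "complex ^ 4"
  assumes "number_field K"
    and "finite S" and "\<forall>v\<in>S. finite_place K v"
    and "\<forall>i<4. rational_vec K (a i)"
    and "\<forall>c :: nat \<Rightarrow> complex. (\<Sum>i<4. c i *s a i) = 0 \<longrightarrow> (\<forall>i<4. c i = 0)"
    and "\<forall>j<r. rational_vec K (u j) \<and> rational_vec K (w j)"
    and "\<forall>j<r. \<forall>s t. s *s u j + t *s w j = 0 \<longrightarrow> s = 0 \<and> t = 0"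
    and "p \<noteq> 0" and "rational_vec K p"
    and "\<forall>j<r. p \<in> line_cone (u j) (w j)"
    and "\<forall>j<r. \<forall>k<4. \<forall>l<4. k < l \<longrightarrow>
           line_cone (u j) (w j) \<inter> plane_cone (a k) \<inter> plane_cone (a l) \<subseteq> {0}"
  shows "potentially_dense K S
           ((\<Union>i<4. plane_cone (a i)) \<union> (\<Union>j<r. line_cone (u j) (w j)))"
proof -
  interpret numfield K by unfold_locales (rule assms)
  obtain b where b: "\<And>i. i < 4 \<Longrightarrow> rational_vec K (b i)"
    "\<And>i j. i < 4 \<Longrightarrow> j < 4 \<Longrightarrow> lf (a i) (b j) = (if i = j then 1 else 0)"
    "\<And>x. x = (\<Sum>i<4. lf (a i) x *s b i)"
    using exists_dual_basis[OF assms(4,5)] by blast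
  \<comment> \<open>The symmetric version is required because the transposition of indices below may
    reverse the order of \<open>k\<close> and \<open>l\<close>.\<close>
  have disj: "line_cone (u j) (w j) \<inter> plane_cone (a k) \<inter> plane_cone (a l) \<subseteq> {0}"
    if "j < r" "k < 4" "l < 4" "k \<noteq> l" for j k l
    using assms(11)[rule_format, of j k l] assms(11)[rule_format, of j l k] that
    by (cases "k < l") auto
  text \<open>At most one of the planes contains p; a transposition makes it the one of index 0.\<close>
  obtain i0 q where i0: "i0 < 4" and q: "rational_vec K q" "\<And>i. i < 4 \<Longrightarrow> i \<noteq> i0 \<Longrightarrow> lf (a i) q \<noteq> 0"
    "\<And>j. j < r \<Longrightarrow> q \<in> line_cone (u j) (w j)"
  proof (cases "r = 0")
    case True
    \<comment> \<open>Without lines \<open>p\<close> may lie on several planes, so it is replaced by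
      a point whose coordinates 1, 2, 3 are nonzero.\<close>
    let ?q = "b 1 + b 2 + b 3"
    have "rational_vec K ?q" using b(1) by (auto simp: rational_vec_def intro!: K_add)
    moreover have "lf (a i) ?q \<noteq> 0" if "i < 4" "i \<noteq> 0" for i
    proof -
      have "i = 1 \<or> i = 2 \<or> i = 3" using \<open>i < 4\<close> \<open>i \<noteq> 0\<close> by auto
      then show ?thesis using b(2) by (auto simp: lf_add)
    qed
    ultimately show ?thesis using that[of 0 ?q] True by simp
  next
    case False
    have uniq: "i = i'" if "i < 4" "i' < 4" "lf (a i) p = 0" "lf (a i') p = 0" for i i'
    proof (rule ccontr)
      assume "i \<noteq> i'"
      then have "p \<in> {0}"
        using disj[of 0 i i'] \<open>i < 4\<close> \<open>i' < 4\<close> \<open>lf (a i) p = 0\<close> \<open>lf (a i') p = 0\<close> False assms(10)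
        by (auto simp: plane_cone_def)
      then show False using assms(8) by simp
    qed
    show ?thesis
    proof (cases "\<exists>i<4. lf (a i) p = 0")
      case True
      then obtain i where "i < 4" "lf (a i) p = 0" by blast
      then show ?thesis using that[of i p] uniq assms(9,10) by blast
    next
      case False
      then show ?thesis using that[of 0 p] assms(9,10) by auto
    qed
  qed
  define \<sigma> where "\<sigma> i = (if i = 0 then i0 else if i = i0 then 0 else i)" for i
  have \<sigma>: "\<sigma> i < 4" if "i < 4" for i using that i0 by (simp add: \<sigma>_def)
  have \<sigma>\<sigma>: "\<sigma> (\<sigma> i) = i" for i by (simp add: \<sigma>_def)
  interpret plane_line_configuration K "\<lambda>i. a (\<sigma> i)" "\<lambda>i. b (\<sigma> i)" q u w r
  proof unfold_locales
    show "x = (\<Sum>i<4. lf (a (\<sigma> i)) x *s b (\<sigma> i))" for x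
      by (rule trans[OF b(3)], rule sum.reindex_bij_witness[of _ \<sigma> \<sigma>]) (auto simp: \<sigma> \<sigma>\<sigma>)
    show "lf (a (\<sigma> i)) (b (\<sigma> j)) = (if i = j then 1 else 0)" if "i < 4" "j < 4" for i j
      using b(2)[OF \<sigma> \<sigma>, OF that] \<sigma>\<sigma> by metis
    show "lf (a (\<sigma> i)) q \<noteq> 0" if "i \<in> {1, 2, 3}" for i
      using that i0 by (intro q(2) \<sigma>) (auto simp: \<sigma>_def)
    show "lf (a (\<sigma> k)) (u j) * lf (a (\<sigma> l)) (w j) - lf (a (\<sigma> l)) (u j) * lf (a (\<sigma> k)) (w j) \<noteq> 0"
      if "j < r" "k < l" "l < 4" for j k l
    proof (rule minor_nonzero_if_disjoint)
      have "\<sigma> k \<noteq> \<sigma> l" using that \<sigma>\<sigma> by (metis less_irrefl)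
      then show "line_cone (u j) (w j) \<inter> plane_cone (a (\<sigma> k)) \<inter> plane_cone (a (\<sigma> l)) \<subseteq> {0}"
        using that \<sigma> by (intro disj) auto
    qed (use assms(7) that in blast)
  qed (use assms(6) \<sigma> b(1) q assms(4) in auto)
  have "D = (\<Union>i<4. plane_cone (a i)) \<union> (\<Union>j<r. line_cone (u j) (w j))"
  proof -
    have "(\<Union>i<4. plane_cone (a (\<sigma> i))) = (\<Union>i<4. plane_cone (a i))"
    proof (intro equalityI UN_least)
      show "plane_cone (a i) \<subseteq> (\<Union>i<4. plane_cone (a (\<sigma> i)))" if "i \<in> {..<4}" for i
        using UN_upper[of "\<sigma> i" "{..<4}" "\<lambda>i. plane_cone (a (\<sigma> i))"] that \<sigma> \<sigma>\<sigma> by simp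
    qed (use \<sigma> in auto)
    then show ?thesis by (simp add: D_def)
  qed
  then show ?thesis using potentially_dense_D[OF assms(2,3)] by simp
qed

end
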